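(* Consider the codimension-one wall-adjacency graph on the $21$ vertices $\Phi_1,\dots,\Phi_{21}$ (the closed strata of the strictly semistable locus of cubic fivefolds attached to the vectors $\mathbf r_1,\dots,\mathbf r_{21}$), with adjacency as defined in the context. This graph has exactly $56$ edges, and for each $k$ the neighbor set $N(k)=\{j\ne k:\Phi_k\text{ is adjacent to }\Phi_j\}$ is: $N(1)=\{3,5,7,10\}$, $N(2)=\{3,4,5,9\}$, $N(3)=\{1,2,4,5,9,10,12\}$, $N(4)=\{2,3,5,6,12,13,18\}$, $N(5)=\{1,2,3,4,6,7,12\}$, $N(6)=\{4,5,12,15\}$, $N(7)=\{1,5,12,17\}$, $N(8)=\{10,11,13,15,16,19\}$, $N(9)=\{2,3,10,14,18,19\}$, $N(10)=\{1,3,8,9,11,14,18\}$, $N(11)=\{8,10,14\}$, $N(12)=\{3,4,5,6,7,15,17\}$, $N(13)=\{4,8,18,19\}$, $N(14)=\{9,10,11,18\}$, $N(15)=\{6,8,12,17,18,20\}$, $N(16)=\{8,18,19\}$, $N(17)=\{7,12,15,18,19,20,21\}$, $N(18)=\{4,9,10,13,14,15,16,17,20\}$, $N(19)=\{8,9,13,16,17,21\}$, $N(20)=\{15,17,18,21\}$, $N(21)=\{17,19,20\}$. All other unordered pairs $\{\Phi_i,\Phi_j\}$ are not adjacent. In particular, the graph has no isolated vertices.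
   Context: $I=\{\mathbf i\in\mathbb{Z}^7_{\ge0}:\sum_j i_j=3\}$, $\mathbb{Z}^7_{(0)}=\{\mathbf r\in\mathbb{Z}^7:\sum_j r_j=0\}$, $I(\mathbf r)_{\ge0}=\{\mathbf i\in I:\mathbf r\cdot\mathbf i\ge0\}$, $I(\mathbf r)_{=0}=\{\mathbf i\in I:\mathbf r\cdot\mathbf i=0\}$. $\Phi_k$ is the set of semistable points $[f]$ of $\mathbb{P}(\mathrm{Sym}^3\mathbb{C}^7)$, $\mathrm{Sym}^3\mathbb{C}^7=\mathbb{C}[x_0,\dots,x_6]_3$, such that for some linear change of coordinates in $\mathrm{SL}(7)$ the exponents of the monomials of $f$ lie in $I(\mathbf r_k)_{\ge0}$. The vectors are: $\mathbf r_1=(8,3,2,-1,-2,-4,-6)$, $\mathbf r_2=(6,4,1,-1,-2,-3,-5)$, $\mathbf r_3=(4,2,1,-1,-1,-2,-3)$, $\mathbf r_4=(3,2,1,0,-1,-2,-3)$, $\mathbf r_5=(4,2,1,0,-1,-2,-4)$, $\mathbf r_6=(5,3,2,1,-1,-4,-6)$, $\mathbf r_7=(6,4,2,1,-2,-3,-8)$, $\mathbf r_8=(4,1,1,0,-2,-2,-2)$, $\mathbf r_9=(2,2,0,0,-1,-1,-2)$, $\mathbf r_{10}=(2,1,0,0,-1,-1,-1)$, $\mathbf r_{11}=(2,0,0,0,0,-1,-1)$, $\mathbf r_{12}=(3,2,1,1,-1,-2,-4)$, $\mathbf r_{13}=(2,1,1,0,-1,-1,-2)$, $\mathbf r_{14}=(2,2,0,-1,-1,-1,-1)$,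 $\mathbf r_{15}=(2,1,1,0,0,-2,-2)$, $\mathbf r_{16}=(2,1,0,0,0,-1,-2)$, $\mathbf r_{17}=(1,1,1,0,0,-1,-2)$, $\mathbf r_{18}=(1,1,0,0,0,-1,-1)$, $\mathbf r_{19}=(2,2,2,0,-1,-1,-4)$, $\mathbf r_{20}=(1,1,1,1,0,-2,-2)$, $\mathbf r_{21}=(1,1,0,0,0,0,-2)$. Adjacency. $\Phi_i$ and $\Phi_j$ are adjacent if $I(\mathbf r_i)_{\ge0}$ and $I(\mathbf r_j)_{\ge0}$ meet along a codimension-one face (a wall) in the Hilbert--Mumford weight fan. In the combinatorial model used this means the following. For fixed $k$, consider the subsets $I(\mathbf r)_{\ge0}\cap I(\mathbf r_k)_{=0}$ of $I(\mathbf r_k)_{=0}$, for $\mathbf r\in\mathbb{Z}^7_{(0)}$ not parallel to $\mathbf r_k$; those that are inclusion-maximal among all subsets of this form are the maximal slices in $I(\mathbf r_k)_{=0}$. Write $k\rightsquigarrow j$ if some maximal slice in $I(\mathbf r_k)_{=0}$ equals $I(\mathbf r_j)_{\ge0}\cap I(\mathbf r_k)_{=0}$ or $I(-\mathbf r_j)_{\ge0}\cap I(\mathbf r_k)_{=0}$. Then $\Phi_i$ and $\Phi_j$ ($i\ne j$) are adjacent if and only if $i\rightsquigarrow j$ and $j\rightsquigarrow i$. *)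

theory Defs
  imports "HOL-Analysis.Analysis"
begin

definition exponents :: "(nat^7) set" where
  "exponents = {i. (\<Sum>j\<in>UNIV. i $ j) = 3}"

definition zero_sum_weights :: "(int^7) set" where
  "zero_sum_weights = {r. (\<Sum>j\<in>UNIV. r $ j) = 0}"

definition weight :: "int^7 \<Rightarrow> nat^7 \<Rightarrow> int" where
  "weight r i = (\<Sum>j\<in>UNIV. r $ j * int (i $ j))"

definition exps_ge :: "int^7 \<Rightarrow> (nat^7) set" where
  "exps_ge r = {i \<in> exponents. weight r i \<ge> 0}"

definition exps_eq :: "int^7 \<Rightarrow> (nat^7) set" where
  "exps_eq r = {i \<in> exponents. weight r i = 0}"

text \<open>
  The library function \<^const>\<open>vector\<close> numbers the entries of a list from 1, so the entry
  belonging to the variable $x_j$ has index $j+1$ (and the last index, 7, is 0 in the type 7).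
  The vectors are numbered from 1 to 21.
\<close>

definition wvec :: "nat \<Rightarrow> int^7" where
  "wvec k =
    [vector [8, 3, 2, -1, -2, -4, -6],
     vector [6, 4, 1, -1, -2, -3, -5],
     vector [4, 2, 1, -1, -1, -2, -3],
     vector [3, 2, 1, 0, -1, -2, -3],
     vector [4, 2, 1, 0, -1, -2, -4],
     vector [5, 3, 2, 1, -1, -4, -6],
     vector [6, 4, 2, 1, -2, -3, -8],
     vector [4, 1, 1, 0, -2, -2, -2],
     vector [2, 2, 0, 0, -1, -1, -2],
     vector [2, 1, 0, 0, -1, -1, -1],
     vector [2, 0, 0, 0, 0, -1, -1],
     vector [3, 2, 1, 1, -1, -2, -4],
     vector [2, 1, 1, 0, -1, -1, -2],
     vector [2, 2, 0, -1, -1, -1, -1],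
     vector [2, 1, 1, 0, 0, -2, -2],
     vector [2, 1, 0, 0, 0, -1, -2],
     vector [1, 1, 1, 0, 0, -1, -2],
     vector [1, 1, 0, 0, 0, -1, -1],
     vector [2, 2, 2, 0, -1, -1, -4],
     vector [1, 1, 1, 1, 0, -2, -2],
     vector [1, 1, 0, 0, 0, 0, -2]] ! (k - 1)"

text \<open>
  A cubic form in seven variables is given by its coefficient function, which vanishes outside
  the exponent set.
\<close>

definition cubics :: "(nat^7 \<Rightarrow> complex) set" where
  "cubics = {c. \<forall>i. i \<notin> exponents \<longrightarrow> c i = 0}"

definition cubic_value :: "(nat^7 \<Rightarrow> complex) \<Rightarrow> complex^7 \<Rightarrow> complex" where
  "cubic_value c x = (\<Sum>i\<in>exponents. c i * (\<Prod>j\<in>UNIV. (x $ j) ^ (i $ j)))"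

definition SL7 :: "(complex^7^7) set" where
  "SL7 = {A. det A = 1}"

text \<open>
  The form \<open>c'\<close> arises from \<open>c\<close> by the linear substitution \<open>A\<close>. As the complex numbers are
  infinite, the polynomial function determines the coefficients of \<open>c'\<close>.
\<close>

definition substitution_of :: "complex^7^7 \<Rightarrow> (nat^7 \<Rightarrow> complex) \<Rightarrow> (nat^7 \<Rightarrow> complex) \<Rightarrow> bool" where
  "substitution_of A c c' \<longleftrightarrow>
     c \<in> cubics \<and> c' \<in> cubics \<and> (\<forall>x. cubic_value c' x = cubic_value c (A *v x))"

text \<open>Homogeneous polynomials of degree \<open>d\<close> in the coefficients of a cubic form.\<close>

definition homogeneous_poly :: "nat \<Rightarrow> ((nat^7 \<Rightarrow> complex) \<Rightarrow> complex) \<Rightarrow> bool" where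
  "homogeneous_poly d F \<longleftrightarrow>
     (\<exists>(M :: (nat^7 \<Rightarrow> nat) set) a. finite M \<and> (\<forall>m\<in>M. (\<Sum>i\<in>exponents. m i) = d) \<and>
        (\<forall>c\<in>cubics. F c = (\<Sum>m\<in>M. a m * (\<Prod>i\<in>exponents. c i ^ m i))))"

definition SL7_invariant :: "((nat^7 \<Rightarrow> complex) \<Rightarrow> complex) \<Rightarrow> bool" where
  "SL7_invariant F \<longleftrightarrow> (\<forall>A\<in>SL7. \<forall>c c'. substitution_of A c c' \<longrightarrow> F c' = F c)"

definition semistable :: "(nat^7 \<Rightarrow> complex) \<Rightarrow> bool" where
  "semistable c \<longleftrightarrow> c \<in> cubics \<and>
     (\<exists>d F. d > 0 \<and> homogeneous_poly d F \<and> SL7_invariant F \<and> F c \<noteq> 0)"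

text \<open>The point of projective space given by a nonzero form: all its nonzero multiples.\<close>

definition proj_point :: "(nat^7 \<Rightarrow> complex) \<Rightarrow> (nat^7 \<Rightarrow> complex) set" where
  "proj_point c = {(\<lambda>i. t * c i) | t. t \<noteq> 0}"

definition Phi :: "nat \<Rightarrow> (nat^7 \<Rightarrow> complex) set set" where
  "Phi k = {proj_point c | c. semistable c \<and>
     (\<exists>A\<in>SL7. \<exists>c'. substitution_of A c c' \<and> {i. c' i \<noteq> 0} \<subseteq> exps_ge (wvec k))}"

text \<open>
  The zero vector is parallel to every vector. This matters below: its slice would be the whole
  of \<open>exps_eq s\<close>.
\<close>

definition parallel :: "int^7 \<Rightarrow> int^7 \<Rightarrow> bool" where
  "parallel r s \<longleftrightarrow> (\<exists>a b. (a, b) \<noteq> (0, 0) \<and> a *s r = b *s s)"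

definition slices :: "int^7 \<Rightarrow> (nat^7) set set" where
  "slices s = {exps_ge r \<inter> exps_eq s | r. r \<in> zero_sum_weights \<and> \<not> parallel r s}"

definition maximal_slices :: "int^7 \<Rightarrow> (nat^7) set set" where
  "maximal_slices s = {S \<in> slices s. \<forall>T\<in>slices s. S \<subseteq> T \<longrightarrow> T = S}"

definition leads_to :: "nat \<Rightarrow> nat \<Rightarrow> bool" where
  "leads_to k j \<longleftrightarrow> (\<exists>S\<in>maximal_slices (wvec k).
     S = exps_ge (wvec j) \<inter> exps_eq (wvec k) \<or> S = exps_ge (- wvec j) \<inter> exps_eq (wvec k))"

definition adjacent :: "nat \<Rightarrow> nat \<Rightarrow> bool" where
  "adjacent i j \<longleftrightarrow> i \<noteq> j \<and> leads_to i j \<and> leads_to j i"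

text \<open>
  Adjacency depends on the vector attached to a stratum, so a vertex is a stratum together with
  its number.
\<close>

definition stratum :: "nat \<Rightarrow> nat \<times> (nat^7 \<Rightarrow> complex) set set" where
  "stratum k = (k, Phi k)"

definition wall_vertices :: "(nat \<times> (nat^7 \<Rightarrow> complex) set set) set" where
  "wall_vertices = stratum ` {1..21}"

definition wall_edges :: "(nat \<times> (nat^7 \<Rightarrow> complex) set set) set set" where
  "wall_edges = {{stratum i, stratum j} | i j. i \<in> {1..21} \<and> j \<in> {1..21} \<and> adjacent i j}"

definition neighbors :: "nat \<Rightarrow> nat set" where
  "neighbors k = {j \<in> {1..21}. j \<noteq> k \<and> {stratum k, stratum j} \<in> wall_edges}"

end

theory Submission
  imports Defs
begin

text \<open>
  Fix \<open>s\<close> and let \<open>E = exps_eq s\<close>. A weight \<open>r\<close> cuts out of \<open>E\<close> the slice of points of nonnegative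
  weight, and whether that slice is maximal is a question about linear functionals modulo \<open>s\<close> that
  has a short certificate either way.

  If the slice \<open>S\<close> of \<open>r\<close> is not maximal, a weight \<open>w\<close> with a larger slice proves it. If \<open>S\<close> is
  maximal, then for every \<open>m \<in> E - S\<close> no functional other than a multiple of \<open>s\<close> is nonnegative on
  \<open>S \<union> {m}\<close>, and by Farkas' lemma this means that some combination of the points of \<open>S \<union> {m}\<close> with
  positive coefficients is a multiple of \<open>(1,\<dots>,1)\<close>, on which zero-sum weights vanish. Conversely,
  suppose such a combination exists for every \<open>m \<in> E - S\<close>. A weight \<open>t\<close> whose slice properly
  contains \<open>S\<close> contains some \<open>m\<close>, so each term of the combination for \<open>m\<close> is nonnegative on \<open>t\<close>
  while the sum is zero; hence \<open>t\<close> vanishes on \<open>S\<close>. The combination for any other \<open>m'\<close> then shows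
  that \<open>t\<close> vanishes at \<open>m'\<close> as well, so \<open>t\<close> vanishes on all of \<open>E\<close>. For each of the 21 vectors the
  set \<open>E\<close> spans so much that only the multiples of \<open>s\<close> vanish on it, and \<open>t\<close> is parallel to \<open>s\<close>, which
  is excluded. These are the lemmas \<open>maximal_sliceI\<close> and \<open>not_maximal_sliceI\<close>.

  The rest is a finite verification. For each ordered pair of neighbours there is one of the two
  signs for which the combinations are tabulated (\<open>adjacency_certificate_table\<close>); for each
  unordered pair of distinct non-neighbours, one of the two directions fails for both signs, and
  weights with larger slices are tabulated (\<open>nonadjacency_witnesses\<close>). Together the tables decide
  all 210 pairs. They are checked by rewriting with functions on lists of integers, whose soundness
  with respect to the vectors of the definitions is \<open>certifies_maximal_sound\<close> and
  \<open>certifies_not_maximal_sound\<close>.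
\<close>

section \<open>Criteria for maximality of a slice\<close>

text \<open>
  For nonempty \<open>B\<close> this means that the barycentre of the simplex of exponents lies in the relative
  interior of the convex hull of \<open>B\<close>. The dual form is what the maximality argument consumes.
\<close>

definition balanced :: "(nat^7) set \<Rightarrow> bool" where
  "balanced B \<longleftrightarrow> (\<forall>r\<in>zero_sum_weights. (\<forall>i\<in>B. weight r i \<ge> 0) \<longrightarrow> (\<forall>i\<in>B. weight r i = 0))"

lemma weight_minus: "weight (- r) i = - weight r i"
  by (simp add: weight_def sum_negf)

lemma zero_sum_weights_minus: "- r \<in> zero_sum_weights \<longleftrightarrow> r \<in> zero_sum_weights"
  by (simp add: zero_sum_weights_def sum_negf)

lemma slice_eq: "exps_ge r \<inter> exps_eq s = {i \<in> exps_eq s. weight r i \<ge> 0}"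
  by (auto simp: exps_ge_def exps_eq_def)

text \<open>
  One of \<open>r\<close> and \<open>-r\<close> is nonnegative at \<open>m\<close>, and both vanish on \<open>B\<close>, so balancedness applies to one
  of them.
\<close>

lemma balanced_insert_weight_eq_0:
  assumes "balanced (insert m B)" and "r \<in> zero_sum_weights" and "\<forall>i\<in>B. weight r i = 0"
  shows "weight r m = 0"
proof (cases "weight r m \<ge> 0")
  case True
  then have "\<forall>i\<in>insert m B. weight r i \<ge> 0"
    using assms(3) by simp
  then show ?thesis
    using assms(1,2) unfolding balanced_def by blast
next
  case False
  then have "\<forall>i\<in>insert m B. weight (- r) i \<ge> 0"
    using assms(3) by (simp add: weight_minus)
  moreover have "- r \<in> zero_sum_weights"
    using assms(2) by (simp add: zero_sum_weights_minus)
  ultimately have "weight (- r) m = 0"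
    using assms(1) unfolding balanced_def by blast
  then show ?thesis
    by (simp add: weight_minus)
qed

text \<open>
  A weight \<open>t\<close> with a larger slice keeps some \<open>m\<close> that \<open>r\<close> discards. Balancedness of the slice with
  \<open>m\<close> forces \<open>t\<close> to vanish on the slice, balancedness with each other discarded point forces it to
  vanish there too, and the third hypothesis makes \<open>t\<close> parallel to \<open>s\<close>. The cone of weights that
  are nonnegative on the slice need not be a ray, which is why the hypothesis concerns each
  discarded point separately.
\<close>

lemma maximal_sliceI:
  assumes r: "r \<in> zero_sum_weights" "\<not> parallel r s"
    and det: "\<And>t. t \<in> zero_sum_weights \<Longrightarrow> \<forall>i\<in>exps_eq s. weight t i = 0 \<Longrightarrow> parallel t s"
    and bal: "\<And>m. m \<in> exps_eq s \<Longrightarrow> weight r m < 0 \<Longrightarrow>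
      balanced (insert m (exps_ge r \<inter> exps_eq s))"
  shows "exps_ge r \<inter> exps_eq s \<in> maximal_slices s"
proof -
  let ?S = "exps_ge r \<inter> exps_eq s"
  have "\<forall>T\<in>slices s. ?S \<subseteq> T \<longrightarrow> T = ?S"
  proof (intro ballI impI, rule ccontr)
    fix T assume T: "T \<in> slices s" and sub: "?S \<subseteq> T" and "T \<noteq> ?S"
    from sub \<open>T \<noteq> ?S\<close> obtain m where m: "m \<in> T" "m \<notin> ?S"
      by blast
    obtain t where t: "T = exps_ge t \<inter> exps_eq s" "t \<in> zero_sum_weights" "\<not> parallel t s"
      using T unfolding slices_def by blast
    have mE: "m \<in> exps_eq s" "weight r m < 0"
      using m by (auto simp: t(1) slice_eq)
    have "\<forall>i\<in>insert m ?S. weight t i \<ge> 0"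
      using m(1) sub by (auto simp: t(1) slice_eq)
    then have zero: "\<forall>i\<in>insert m ?S. weight t i = 0"
      using bal[OF mE] t(2) unfolding balanced_def by blast
    have "weight t i = 0" if "i \<in> exps_eq s" for i
    proof (cases "weight r i \<ge> 0")
      case True
      then show ?thesis
        using zero that by (simp add: slice_eq)
    next
      case False
      then show ?thesis
        using balanced_insert_weight_eq_0[OF bal[OF that] t(2)] zero by simp
    qed
    then show False
      using det t(2,3) by blast
  qed
  moreover have "?S \<in> slices s"
    unfolding slices_def using r by blast
  ultimately show ?thesis
    unfolding maximal_slices_def mem_Collect_eq by (intro conjI)
qed

lemma not_maximal_sliceI:
  assumes "w \<in> zero_sum_weights" "\<not> parallel w s"
    and "\<And>i. i \<in> exps_eq s \<Longrightarrow> weight r i \<ge> 0 \<Longrightarrow> weight w i \<ge> 0"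
    and "m \<in> exps_eq s" "weight r m < 0" "weight w m \<ge> 0"
  shows "exps_ge r \<inter> exps_eq s \<notin> maximal_slices s"
proof
  assume "exps_ge r \<inter> exps_eq s \<in> maximal_slices s"
  then have largest: "\<forall>T\<in>slices s. exps_ge r \<inter> exps_eq s \<subseteq> T \<longrightarrow> T = exps_ge r \<inter> exps_eq s"
    by (simp add: maximal_slices_def)
  have "exps_ge w \<inter> exps_eq s \<in> slices s"
    using assms(1,2) unfolding slices_def by blast
  moreover have "exps_ge r \<inter> exps_eq s \<subseteq> exps_ge w \<inter> exps_eq s"
    using assms(3) by (auto simp: slice_eq)
  ultimately have eq: "exps_ge w \<inter> exps_eq s = exps_ge r \<inter> exps_eq s"
    by (rule largest[rule_format])
  have "m \<in> exps_ge w \<inter> exps_eq s"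
    using assms(4,6) by (simp add: slice_eq)
  then have "m \<in> exps_ge r \<inter> exps_eq s"
    unfolding eq .
  then show False
    using assms(5) by (simp add: slice_eq)
qed

section \<open>Positive combinations of exponent lists\<close>

text \<open>
  For computation, weights and exponents are lists of integers, so that a single pairing serves
  both.
\<close>

fun dot :: "int list \<Rightarrow> int list \<Rightarrow> int" where
  "dot (x # xs) (y # ys) = x * y + dot xs ys"
| "dot xs ys = 0"

definition lin :: "int \<Rightarrow> int list \<Rightarrow> int \<Rightarrow> int list \<Rightarrow> int list" where
  "lin a xs b ys = map2 (\<lambda>x y. a * x + b * y) xs ys"

lemma dot_lin_right:
  "length xs = length ys \<Longrightarrow> dot q (lin a xs b ys) = a * dot q xs + b * dot q ys"
proof (induction q arbitrary: xs ys)
  case (Cons c q)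
  then show ?case
    by (cases xs; cases ys) (auto simp: lin_def algebra_simps)
qed simp

lemma dot_commute: "dot xs ys = dot ys xs"
proof (induction xs arbitrary: ys)
  case Nil
  show ?case by (cases ys) auto
next
  case (Cons x xs)
  then show ?case by (cases ys) (auto simp: mult.commute)
qed

lemma dot_lin_left:
  "length xs = length ys \<Longrightarrow> dot (lin a xs b ys) q = a * dot xs q + b * dot ys q"
  by (metis dot_commute dot_lin_right)

lemma length_lin [simp]: "length (lin a xs b ys) = min (length xs) (length ys)"
  by (simp add: lin_def)

lemma dot_constant:
  "length xs = length ys \<Longrightarrow> \<forall>y\<in>set ys. y = c \<Longrightarrow> dot xs ys = c * sum_list xs"
  by (induction xs ys rule: list_induct2) (auto simp: algebra_simps)

fun combination :: "int list \<Rightarrow> int list list \<Rightarrow> int list" where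
  "combination (c # cs) (e # es) = lin c e 1 (combination cs es)"
| "combination _ _ = [0, 0, 0, 0, 0, 0, 0]"

definition balancing :: "int list \<Rightarrow> int list list \<Rightarrow> bool" where
  "balancing cs es \<longleftrightarrow> length cs = length es \<and> list_all (\<lambda>c. c > 0) cs \<and>
     list_all (\<lambda>x. x = hd (combination cs es)) (combination cs es)"

lemma length_combination:
  "length cs = length es \<Longrightarrow> \<forall>e\<in>set es. length e = 7 \<Longrightarrow> length (combination cs es) = 7"
  by (induction cs es rule: list_induct2) auto

lemma dot_combination:
  assumes "length cs = length es" "\<forall>e\<in>set es. length e = 7"
  shows "dot x (combination cs es) = sum_list (map2 (\<lambda>c e. c * dot x e) cs es)"
  using assms
proof (induction cs es rule: list_induct2)
  case Nil
  have "dot zs x = 0" if "\<forall>z\<in>set zs. z = 0" for zs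
    using that by (induction zs x rule: dot.induct) auto
  then have "dot [0, 0, 0, 0, 0, 0, 0] x = 0"
    by simp
  then show ?case by (simp add: dot_commute[of x])
next
  case (Cons c cs e es)
  then show ?case
    by (simp add: dot_lin_right length_combination)
qed

text \<open>
  Pairing \<open>x\<close> with the combination gives a multiple of the entry sum of \<open>x\<close>, which is zero. It is
  also a sum of nonnegative terms, so every term is zero, and the coefficients are positive.
\<close>

lemma balancing_imp_dot_eq_0:
  assumes bal: "balancing cs es" and es: "\<forall>e\<in>set es. length e = 7"
    and x: "length x = 7" "sum_list x = 0" and nonneg: "\<forall>e\<in>set es. dot x e \<ge> 0"
    and "e \<in> set es"
  shows "dot x e = 0"
proof -
  let ?ts = "map2 (\<lambda>c e. c * dot x e) cs es"
  have len: "length cs = length es" and pos: "\<forall>c\<in>set cs. c > 0"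
    using bal by (auto simp: balancing_def list_all_iff)
  have "sum_list ?ts = dot x (combination cs es)"
    using dot_combination[OF len es] by simp
  also have "\<dots> = hd (combination cs es) * sum_list x"
    using bal x(1) length_combination[OF len es]
    by (intro dot_constant) (auto simp: balancing_def list_all_iff)
  finally have "sum_list ?ts = 0"
    using x(2) by simp
  moreover have "t \<ge> 0" if "t \<in> set ?ts" for t
  proof -
    obtain c e where "(c, e) \<in> set (zip cs es)" "t = c * dot x e"
      using \<open>t \<in> set ?ts\<close> by auto
    moreover from this(1) have "c > 0" "dot x e \<ge> 0"
      using pos nonneg by (blast dest: set_zip_leftD set_zip_rightD)+
    ultimately show ?thesis
      by simp
  qed
  ultimately have zero: "\<forall>t\<in>set ?ts. t = 0"
    by (meson sum_list_nonneg_eq_0_iff)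
  obtain n where n: "n < length es" "e = es ! n"
    using \<open>e \<in> set es\<close> by (metis in_set_conv_nth)
  then have "cs ! n * dot x e = 0"
    using zero len by (auto simp: set_conv_nth)
  then show ?thesis
    using pos n len by (metis less_irrefl mult_eq_0_iff nth_mem)
qed

section \<open>Weights determined by the points where they vanish\<close>

text \<open>
  Only the minors with the first entry are compared. For lists whose reference \<open>ys\<close> starts with a
  nonzero entry this says that \<open>xs\<close> is a rational multiple of \<open>ys\<close>.
\<close>

definition proportional :: "int list \<Rightarrow> int list \<Rightarrow> bool" where
  "proportional xs ys \<longleftrightarrow> map ((*) (hd ys)) xs = map ((*) (hd xs)) ys"

text \<open>
  One step of fraction-free Gaussian elimination: a generating set of a space of weights is turned
  into one of the subspace that vanishes at \<open>e\<close>. The pivot \<open>p\<close> itself becomes the zero vector and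
  may stay in the list.
\<close>

definition eliminate :: "int list list \<Rightarrow> int list \<Rightarrow> int list list" where
  "eliminate vs e = (case filter (\<lambda>v. dot v e \<noteq> 0) vs of
      [] \<Rightarrow> vs
    | p # _ \<Rightarrow> map (\<lambda>v. lin (dot p e) v (- dot v e) p) vs)"

definition zero_sum_basis :: "int list list" where
  "zero_sum_basis =
    [[1, -1, 0, 0, 0, 0, 0],
     [0, 1, -1, 0, 0, 0, 0],
     [0, 0, 1, -1, 0, 0, 0],
     [0, 0, 0, 1, -1, 0, 0],
     [0, 0, 0, 0, 1, -1, 0],
     [0, 0, 0, 0, 0, 1, -1]]"

definition determines :: "int list list \<Rightarrow> int list \<Rightarrow> bool" where
  "determines es s \<longleftrightarrow>
     hd s \<noteq> 0 \<and> list_all (\<lambda>v. proportional v s) (foldl eliminate zero_sum_basis es)"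

text \<open>
  Membership in the rational span of \<open>vs\<close>, expressed by duality. In this form elimination can be
  followed without keeping track of coefficients or denominators.
\<close>

definition in_double_annihilator :: "int list \<Rightarrow> int list list \<Rightarrow> bool" where
  "in_double_annihilator x vs \<longleftrightarrow>
     (\<forall>q. length q = length x \<longrightarrow> (\<forall>v\<in>set vs. dot q v = 0) \<longrightarrow> dot q x = 0)"

lemma length_eliminate:
  assumes "\<forall>v\<in>set vs. length v = n"
  shows "\<forall>v\<in>set (eliminate vs e). length v = n"
proof (cases "filter (\<lambda>v. dot v e \<noteq> 0) vs")
  case Nil
  then show ?thesis
    using assms by (simp add: eliminate_def)
next
  case (Cons p ps)
  then have "p \<in> set (filter (\<lambda>v. dot v e \<noteq> 0) vs)"
    by simp
  then have "p \<in> set vs"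
    by simp
  then show ?thesis
    using assms Cons by (simp add: eliminate_def)
qed

lemma length_foldl_eliminate:
  "\<forall>v\<in>set vs. length v = n \<Longrightarrow> \<forall>v\<in>set (foldl eliminate vs es). length v = n"
proof (induction es arbitrary: vs)
  case (Cons e es)
  show ?case
    using Cons.IH[OF length_eliminate[OF Cons.prems]] by simp
qed simp

text \<open>
  If \<open>q\<close> annihilates the eliminated vectors, then \<open>(p \<cdot> e) q - (q \<cdot> p) e\<close> annihilates the original
  ones: this is the same elimination step, transposed. It therefore annihilates \<open>x\<close>, and as
  \<open>x \<cdot> e = 0\<close> and \<open>p \<cdot> e \<noteq> 0\<close>, so does \<open>q\<close>.
\<close>

lemma in_double_annihilator_eliminate:
  assumes x: "in_double_annihilator x vs" "dot x e = 0"
    and len: "\<forall>v\<in>set vs. length v = length x" "length e = length x"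
  shows "in_double_annihilator x (eliminate vs e)"
proof (cases "filter (\<lambda>v. dot v e \<noteq> 0) vs")
  case Nil
  then show ?thesis using x(1) by (simp add: eliminate_def)
next
  case (Cons p ps)
  then have "p \<in> set (filter (\<lambda>v. dot v e \<noteq> 0) vs)"
    by simp
  then have p: "p \<in> set vs" "dot p e \<noteq> 0"
    by simp_all
  show ?thesis
    unfolding in_double_annihilator_def
  proof (intro allI impI)
    fix q assume q: "length q = length x" "\<forall>v\<in>set (eliminate vs e). dot q v = 0"
    let ?q = "lin (dot p e) q (- dot q p) e"
    have "dot ?q v = 0" if v: "v \<in> set vs" for v
    proof -
      have "dot ?q v = dot q (lin (dot p e) v (- dot v e) p)"
        using v p(1) len q(1) by (simp add: dot_lin_left dot_lin_right dot_commute[of e])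
      also have "\<dots> = 0"
        using q(2) v Cons by (simp add: eliminate_def)
      finally show ?thesis .
    qed
    then have "dot ?q x = 0"
      using x(1) q(1) len(2) by (simp add: in_double_annihilator_def)
    then show "dot q x = 0"
      using p(2) q(1) len(2) x(2) by (simp add: dot_lin_left dot_commute[of e])
  qed
qed

lemma in_double_annihilator_foldl:
  assumes "in_double_annihilator x vs" "\<forall>v\<in>set vs. length v = length x"
    and "\<forall>e\<in>set es. length e = length x \<and> dot x e = 0"
  shows "in_double_annihilator x (foldl eliminate vs es)"
  using assms
proof (induction es arbitrary: vs)
  case (Cons e es)
  have "in_double_annihilator x (eliminate vs e)"
    using Cons.prems in_double_annihilator_eliminate by simp
  then have "in_double_annihilator x (foldl eliminate (eliminate vs e) es)"
    using Cons.IH[OF _ length_eliminate[OF Cons.prems(2)]] Cons.prems(3) by simp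
  then show ?case by simp
qed simp

lemma length_7_conv:
  "length xs = 7 \<longleftrightarrow> (\<exists>a b c d e f g. xs = [a, b, c, d, e, f, g])"
proof
  assume "length xs = 7"
  then have "xs = map ((!) xs) [0..<7]"
    using map_nth[of xs] by simp
  also have "\<dots> = [xs ! 0, xs ! 1, xs ! 2, xs ! 3, xs ! 4, xs ! 5, xs ! 6]"
    by (simp add: upt_rec numeral_eq_Suc)
  finally show "\<exists>a b c d e f g. xs = [a, b, c, d, e, f, g]"
    by blast
qed auto

lemma in_double_annihilator_zero_sum_basis:
  assumes "length x = 7" "sum_list x = 0"
  shows "in_double_annihilator x zero_sum_basis"
  unfolding in_double_annihilator_def
proof (intro allI impI)
  fix q assume q: "length q = length x" "\<forall>v\<in>set zero_sum_basis. dot q v = 0"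
  then obtain a b c d e f g where "q = [a, b, c, d, e, f, g]"
    using assms(1) length_7_conv by metis
  then have "\<forall>y\<in>set q. y = a"
    using q(2) by (auto simp: zero_sum_basis_def)
  then show "dot q x = 0"
    using dot_constant[of x q a] q(1) assms(2) by (simp add: dot_commute)
qed

text \<open>
  The minors that express proportionality to \<open>s\<close> are linear functionals. They annihilate every
  vector that survives the elimination, hence also \<open>x\<close>.
\<close>

lemma determines_imp_proportional:
  assumes det: "determines es s" and s: "length s = 7"
    and x: "length x = 7" "sum_list x = 0" and es: "\<forall>e\<in>set es. length e = 7 \<and> dot x e = 0"
  shows "proportional x s"
proof -
  let ?vs = "foldl eliminate zero_sum_basis es"
  have basis: "\<forall>v\<in>set zero_sum_basis. length v = 7"
    by (simp add: zero_sum_basis_def)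
  have ann: "in_double_annihilator x ?vs"
    using basis es x
    by (intro in_double_annihilator_foldl in_double_annihilator_zero_sum_basis) simp_all
  have len: "\<forall>v\<in>set ?vs. length v = 7"
    using length_foldl_eliminate[OF basis] .
  obtain s0 s1 s2 s3 s4 s5 s6 where s': "s = [s0, s1, s2, s3, s4, s5, s6]"
    using s length_7_conv by metis
  obtain x0 x1 x2 x3 x4 x5 x6 where x': "x = [x0, x1, x2, x3, x4, x5, x6]"
    using x length_7_conv by metis
  have minor: "dot q x = 0" if "length q = 7" and
    q: "\<And>a b c d e f g. proportional [a, b, c, d, e, f, g] s \<Longrightarrow> dot q [a, b, c, d, e, f, g] = 0"
    for q
  proof -
    have "dot q v = 0" if "v \<in> set ?vs" for v
    proof -
      have "length v = 7" "proportional v s"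
        using len det that by (auto simp: determines_def list_all_iff)
      then show ?thesis
        using q length_7_conv by metis
    qed
    then show ?thesis
      using ann \<open>length q = 7\<close> x(1) by (simp add: in_double_annihilator_def)
  qed
  have "dot [s1, - s0, 0, 0, 0, 0, 0] x = 0" "dot [s2, 0, - s0, 0, 0, 0, 0] x = 0"
    "dot [s3, 0, 0, - s0, 0, 0, 0] x = 0" "dot [s4, 0, 0, 0, - s0, 0, 0] x = 0"
    "dot [s5, 0, 0, 0, 0, - s0, 0] x = 0" "dot [s6, 0, 0, 0, 0, 0, - s0] x = 0"
    by (rule minor; simp add: proportional_def s' algebra_simps)+
  then show ?thesis
    by (simp add: x' s' proportional_def algebra_simps)
qed

section \<open>From vectors to lists\<close>

lemma UNIV_7: "(UNIV :: 7 set) = {1, 2, 3, 4, 5, 6, 7}"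
  by (rule sym, rule card_eq_UNIV_imp_eq_UNIV) simp_all

lemma sum_7: "(\<Sum>j\<in>(UNIV :: 7 set). f j) = f 1 + f 2 + f 3 + f 4 + f 5 + f 6 + f 7"
  unfolding UNIV_7 by (simp add: add.assoc)

text \<open>
  The order of the entries is that of the library function \<^const>\<open>vector\<close>, so the last index,
  which is 0 in the type 7, stays last.
\<close>

definition entries :: "'a^7 \<Rightarrow> 'a list" where
  "entries r = [r $ 1, r $ 2, r $ 3, r $ 4, r $ 5, r $ 6, r $ 7]"

lemma length_entries [simp]: "length (entries r) = 7"
  by (simp add: entries_def)

lemma entries_vector: "length xs = 7 \<Longrightarrow> entries (vector xs) = (xs :: 'a :: zero list)"
  by (auto simp: length_7_conv entries_def vector_def)

lemma entries_minus: "entries (- r) = map uminus (entries (r :: 'a :: group_add^7))"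
  by (simp add: entries_def)

lemma sum_list_entries: "sum_list (entries r) = (\<Sum>j\<in>UNIV. r $ j)"
  for r :: "'a :: comm_monoid_add^7"
  by (simp add: entries_def sum_7 ac_simps)

lemma zero_sum_weights_iff: "r \<in> zero_sum_weights \<longleftrightarrow> sum_list (entries r) = 0"
  by (simp add: zero_sum_weights_def sum_list_entries)

abbreviation exponent_entries :: "nat^7 \<Rightarrow> int list" where
  "exponent_entries i \<equiv> map int (entries i)"

lemma weight_eq_dot: "weight r i = dot (entries r) (exponent_entries i)"
  by (simp add: weight_def sum_7 entries_def)

fun exponent_lists :: "nat \<Rightarrow> nat \<Rightarrow> int list list" where
  "exponent_lists 0 d = (if d = 0 then [[]] else [])"
| "exponent_lists (Suc n) d =
     concat (map (\<lambda>a. map ((#) (int a)) (exponent_lists n (d - a))) [0..<Suc d])"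

definition zero_exponents :: "int list \<Rightarrow> int list list" where
  "zero_exponents s = filter (\<lambda>e. dot s e = 0) (exponent_lists 7 3)"

lemma set_exponent_lists:
  "set (exponent_lists n d) = map int ` {as. length as = n \<and> sum_list as = d}"
proof (induction n arbitrary: d)
  case 0
  then show ?case by (auto simp: image_iff)
next
  case (Suc n)
  have "xs \<in> set (exponent_lists (Suc n) d) \<longleftrightarrow>
      (\<exists>a as. xs = map int (a # as) \<and> length as = n \<and> sum_list (a # as) = d)" for xs
  proof -
    have "xs \<in> set (exponent_lists (Suc n) d) \<longleftrightarrow>
        (\<exists>a\<le>d. \<exists>ys\<in>set (exponent_lists n (d - a)). xs = int a # ys)"
      by (auto simp: less_Suc_eq_le simp del: upt_Suc)
    also have "\<dots> \<longleftrightarrow>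
        (\<exists>a\<le>d. \<exists>as. length as = n \<and> sum_list as = d - a \<and> xs = map int (a # as))"
      unfolding Suc.IH by auto
    also have "\<dots> \<longleftrightarrow> (\<exists>a as. xs = map int (a # as) \<and> length as = n \<and> sum_list (a # as) = d)"
      by fastforce
    finally show ?thesis .
  qed
  moreover have "xs \<in> map int ` {as. length as = Suc n \<and> sum_list as = d} \<longleftrightarrow>
      (\<exists>a as. xs = map int (a # as) \<and> length as = n \<and> sum_list (a # as) = d)" for xs
  proof -
    have "(\<exists>bs. length bs = Suc n \<and> Q bs) \<longleftrightarrow> (\<exists>a as. length as = n \<and> Q (a # as))"
      for Q :: "nat list \<Rightarrow> bool"
      by (metis length_Suc_conv)
    from this[of "\<lambda>bs. sum_list bs = d \<and> xs = map int bs"] show ?thesis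
      by (simp add: image_iff conj_ac)
  qed
  ultimately show ?case
    by (intro set_eqI) (simp only:)
qed

lemma exponent_entries_image_exponents:
  "exponent_entries ` exponents = set (exponent_lists 7 3)"
proof -
  have "entries ` exponents = {as. length as = 7 \<and> sum_list as = 3}"
  proof (intro equalityI subsetI)
    fix as :: "nat list" assume as: "as \<in> {as. length as = 7 \<and> sum_list as = 3}"
    then have "entries (vector as) = as"
      by (simp add: entries_vector)
    moreover from this have "vector as \<in> exponents"
      using as sum_list_entries[of "vector as :: nat^7"] by (simp add: exponents_def)
    ultimately show "as \<in> entries ` exponents"
      by (metis imageI)
  qed (auto simp: exponents_def sum_list_entries)
  then show ?thesis
    by (simp add: set_exponent_lists image_image[of "map int" entries, symmetric])
qed

lemma exponent_entries_image_exps_eq: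
  "exponent_entries ` exps_eq s = set (zero_exponents (entries s))"
proof -
  have "exponent_entries ` exps_eq s =
      {e \<in> exponent_entries ` exponents. dot (entries s) e = 0}"
    by (auto simp: exps_eq_def weight_eq_dot)
  then show ?thesis
    by (simp only: exponent_entries_image_exponents zero_exponents_def set_filter)
qed

lemma ball_exps_eq_iff:
  "(\<forall>i\<in>exps_eq s. P (exponent_entries i)) \<longleftrightarrow> (\<forall>e\<in>set (zero_exponents (entries s)). P e)"
  by (simp flip: exponent_entries_image_exps_eq)

lemma bex_exps_eq_iff:
  "(\<exists>i\<in>exps_eq s. P (exponent_entries i)) \<longleftrightarrow> (\<exists>e\<in>set (zero_exponents (entries s)). P e)"
  by (simp flip: exponent_entries_image_exps_eq)

lemma length_zero_exponents: "e \<in> set (zero_exponents s) \<Longrightarrow> length e = 7"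
  by (auto simp: zero_exponents_def set_exponent_lists)

text \<open>
  If the coefficient of \<open>r\<close> in the relation is zero, then \<open>s\<close> is zero and all minors vanish;
  otherwise that coefficient can be cancelled.
\<close>

lemma parallel_imp_proportional:
  assumes "parallel r s"
  shows "proportional (entries r) (entries s)"
proof -
  obtain a b where ab: "(a, b) \<noteq> (0, 0)" and eq: "a *s r = b *s s"
    using assms unfolding parallel_def by blast
  have entry: "a * r $ j = b * s $ j" for j
    using arg_cong[OF eq, of "\<lambda>v. v $ j"] by simp
  have "s $ p * r $ q = r $ p * s $ q" for p q
  proof (cases "a = 0")
    case True
    then have "s $ j = 0" for j
      using ab entry[of j] by simp
    then show ?thesis by simp
  next
    case False
    have "a * (s $ p * r $ q) = s $ p * (a * r $ q)"
      by simp
    also have "\<dots> = (a * r $ p) * s $ q"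
      by (simp only: entry) simp
    finally show ?thesis
      using False by simp
  qed
  then show ?thesis
    by (simp add: proportional_def entries_def)
qed

lemma proportional_imp_parallel:
  assumes "proportional (entries r) (entries s)" and "hd (entries s) \<noteq> 0"
  shows "parallel r s"
proof -
  have "\<forall>j\<in>UNIV. s $ 1 * r $ j = r $ 1 * s $ j"
    using assms(1) unfolding UNIV_7 by (simp add: proportional_def entries_def)
  then have "s $ 1 *s r = r $ 1 *s s"
    by (simp add: vec_eq_iff)
  then show ?thesis
    using assms(2) unfolding parallel_def entries_def by auto
qed

section \<open>Certificates for single slices\<close>

text \<open>
  There is one row of coefficients for each discarded point \<open>m\<close>, in the order in which the discarded
  points occur in \<open>es\<close>; within a row, the coefficient of \<open>m\<close> comes first and those of the slice
  follow in the order of \<open>es\<close>.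
\<close>

definition certifies_maximal ::
    "int list \<Rightarrow> int list list \<Rightarrow> int list \<Rightarrow> int list list \<Rightarrow> bool" where
  "certifies_maximal s es r rels \<longleftrightarrow> \<not> proportional r s \<and>
     list_all2 (\<lambda>cs m. balancing cs (m # filter (\<lambda>e. dot r e \<ge> 0) es))
       rels (filter (\<lambda>e. dot r e < 0) es)"

definition certifies_not_maximal ::
    "int list \<Rightarrow> int list list \<Rightarrow> int list \<Rightarrow> int list \<Rightarrow> bool" where
  "certifies_not_maximal s es r w \<longleftrightarrow> length w = 7 \<and> sum_list w = 0 \<and> \<not> proportional w s \<and>
     list_all (\<lambda>e. dot r e \<ge> 0 \<longrightarrow> dot w e \<ge> 0) es \<and>
     list_ex (\<lambda>e. dot r e < 0 \<and> dot w e \<ge> 0) es"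

lemma certifies_maximal_sound:
  assumes cert: "certifies_maximal (entries s) (zero_exponents (entries s)) (entries r) rels"
    and det: "determines (zero_exponents (entries s)) (entries s)"
    and r: "r \<in> zero_sum_weights"
  shows "exps_ge r \<inter> exps_eq s \<in> maximal_slices s"
proof (rule maximal_sliceI[OF r])
  show "\<not> parallel r s"
    using cert parallel_imp_proportional by (auto simp: certifies_maximal_def)
next
  fix t assume t: "t \<in> zero_sum_weights" "\<forall>i\<in>exps_eq s. weight t i = 0"
  have "\<forall>e\<in>set (zero_exponents (entries s)). length e = 7 \<and> dot (entries t) e = 0"
    using t(2) length_zero_exponents
    by (simp add: weight_eq_dot ball_exps_eq_iff[where P = "\<lambda>e. dot (entries t) e = 0"])
  then have "proportional (entries t) (entries s)"
    using det t(1) by (intro determines_imp_proportional) (simp_all add: zero_sum_weights_iff)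
  then show "parallel t s"
    using det by (intro proportional_imp_parallel) (simp_all add: determines_def)
next
  fix m assume m: "m \<in> exps_eq s" "weight r m < 0"
  let ?es = "zero_exponents (entries s)" and ?S = "exps_ge r \<inter> exps_eq s"
  let ?kept = "filter (\<lambda>e. dot (entries r) e \<ge> 0) ?es"
  have mE: "exponent_entries m \<in> set ?es"
    using m(1) exponent_entries_image_exps_eq by blast
  then have "exponent_entries m \<in> set (filter (\<lambda>e. dot (entries r) e < 0) ?es)"
    using m(2) by (simp add: weight_eq_dot)
  then obtain cs where cs: "balancing cs (exponent_entries m # ?kept)"
    using cert unfolding certifies_maximal_def list_all2_conv_all_nth
    by (metis in_set_conv_nth)
  have "exponent_entries ` ?S = {e \<in> exponent_entries ` exps_eq s. dot (entries r) e \<ge> 0}"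
    unfolding slice_eq weight_eq_dot by blast
  then have image: "exponent_entries ` insert m ?S = set (exponent_entries m # ?kept)"
    by (simp add: exponent_entries_image_exps_eq)
  have len: "\<forall>e\<in>set (exponent_entries m # ?kept). length e = 7"
    using mE by (auto dest: length_zero_exponents)
  show "balanced (insert m ?S)"
    unfolding balanced_def
  proof (intro ballI impI)
    fix t i assume t: "t \<in> zero_sum_weights" "\<forall>i\<in>insert m ?S. weight t i \<ge> 0"
      and i: "i \<in> insert m ?S"
    have nonneg: "\<forall>e\<in>set (exponent_entries m # ?kept). dot (entries t) e \<ge> 0"
      using t(2) unfolding image[symmetric] weight_eq_dot by blast
    have "exponent_entries i \<in> set (exponent_entries m # ?kept)"
      using imageI[OF i, of exponent_entries] unfolding image .
    moreover have "sum_list (entries t) = 0"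
      using t(1) by (simp only: zero_sum_weights_iff)
    ultimately show "weight t i = 0"
      unfolding weight_eq_dot by (intro balancing_imp_dot_eq_0[OF cs len _ _ nonneg]) simp_all
  qed
qed

lemma certifies_not_maximal_sound:
  assumes "certifies_not_maximal (entries s) (zero_exponents (entries s)) (entries r) w"
  shows "exps_ge r \<inter> exps_eq s \<notin> maximal_slices s"
proof -
  let ?es = "zero_exponents (entries s)"
  have w: "entries (vector w :: int^7) = w"
    using assms by (simp add: certifies_not_maximal_def entries_vector)
  have keep: "\<forall>e\<in>set ?es. dot (entries r) e \<ge> 0 \<longrightarrow> dot w e \<ge> 0"
    and gain: "\<exists>e\<in>set ?es. dot (entries r) e < 0 \<and> dot w e \<ge> 0"
    using assms by (auto simp: certifies_not_maximal_def list_all_iff list_ex_iff)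
  obtain m where m: "m \<in> exps_eq s"
    "dot (entries r) (exponent_entries m) < 0 \<and> dot w (exponent_entries m) \<ge> 0"
    using gain unfolding bex_exps_eq_iff[symmetric] by blast
  show ?thesis
  proof (rule not_maximal_sliceI)
    show "(vector w :: int^7) \<in> zero_sum_weights"
      using assms by (simp add: zero_sum_weights_iff w certifies_not_maximal_def)
    show "\<not> parallel (vector w) s"
      using assms parallel_imp_proportional[of "vector w" s]
      by (auto simp: w certifies_not_maximal_def)
    show "weight (vector w) i \<ge> 0" if "i \<in> exps_eq s" "weight r i \<ge> 0" for i
      using keep that unfolding ball_exps_eq_iff[symmetric] weight_eq_dot w by blast
    show "m \<in> exps_eq s" "weight r m < 0" "weight (vector w) m \<ge> 0"
      using m unfolding weight_eq_dot w by blast+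
  qed
qed

section \<open>The 21 weight vectors\<close>

definition weight_table :: "int list list" where
  "weight_table =
    [[8, 3, 2, -1, -2, -4, -6],
     [6, 4, 1, -1, -2, -3, -5],
     [4, 2, 1, -1, -1, -2, -3],
     [3, 2, 1, 0, -1, -2, -3],
     [4, 2, 1, 0, -1, -2, -4],
     [5, 3, 2, 1, -1, -4, -6],
     [6, 4, 2, 1, -2, -3, -8],
     [4, 1, 1, 0, -2, -2, -2],
     [2, 2, 0, 0, -1, -1, -2],
     [2, 1, 0, 0, -1, -1, -1],
     [2, 0, 0, 0, 0, -1, -1],
     [3, 2, 1, 1, -1, -2, -4],
     [2, 1, 1, 0, -1, -1, -2],
     [2, 2, 0, -1, -1, -1, -1],
     [2, 1, 1, 0, 0, -2, -2],
     [2, 1, 0, 0, 0, -1, -2],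
     [1, 1, 1, 0, 0, -1, -2],
     [1, 1, 0, 0, 0, -1, -1],
     [2, 2, 2, 0, -1, -1, -4],
     [1, 1, 1, 1, 0, -2, -2],
     [1, 1, 0, 0, 0, 0, -2]]"

lemma length_weight_table: "length weight_table = 21"
  by (simp add: weight_table_def)

lemma nth_weight_table:
  assumes "k \<in> {1..21}"
  shows "length (weight_table ! (k - 1)) = 7" "sum_list (weight_table ! (k - 1)) = 0"
proof -
  have "weight_table ! (k - 1) \<in> set weight_table"
    using assms length_weight_table by (intro nth_mem) auto
  moreover have "\<forall>w\<in>set weight_table. length w = 7 \<and> sum_list w = 0"
    by (simp add: weight_table_def)
  ultimately show "length (weight_table ! (k - 1)) = 7" "sum_list (weight_table ! (k - 1)) = 0"
    by blast+
qed

lemma entries_wvec: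
  assumes k: "k \<in> {1..21}"
  shows "entries (wvec k) = weight_table ! (k - 1)"
proof -
  have "wvec k = map vector weight_table ! (k - 1)"
    by (simp only: wvec_def weight_table_def list.map)
  also have "\<dots> = vector (weight_table ! (k - 1))"
    using k length_weight_table by (intro nth_map) auto
  finally show ?thesis
    using nth_weight_table(1)[OF k] by (simp add: entries_vector)
qed

lemma wvec_zero_sum: "k \<in> {1..21} \<Longrightarrow> wvec k \<in> zero_sum_weights"
  by (simp only: zero_sum_weights_iff entries_wvec nth_weight_table)

section \<open>Tables of certificates\<close>

text \<open>
  The sign in a certificate tells which of the weights of \<open>j\<close> and its negative has a maximal slice;
  one sign suffices.
\<close>

definition certified_slices ::
    "int list \<Rightarrow> int list list \<Rightarrow> (nat \<times> int \<times> int list list) list \<Rightarrow> bool" where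
  "certified_slices s es certs \<longleftrightarrow> determines es s \<and>
     list_all (\<lambda>(j, \<sigma>, rels). (\<sigma> = 1 \<or> \<sigma> = -1) \<and>
       certifies_maximal s es (map ((*) \<sigma>) (weight_table ! (j - 1))) rels) certs"

text \<open>
  Here both signs have to fail: \<open>w\<close> enlarges the slice of the weight of \<open>j\<close>, and \<open>w'\<close> that of its
  negative.
\<close>

definition certified_nonslices ::
    "int list \<Rightarrow> int list list \<Rightarrow> (nat \<times> int list \<times> int list) list \<Rightarrow> bool" where
  "certified_nonslices s es certs \<longleftrightarrow>
     list_all (\<lambda>(j, w, w'). certifies_not_maximal s es (weight_table ! (j - 1)) w \<and>
       certifies_not_maximal s es (map uminus (weight_table ! (j - 1))) w') certs"

text \<open>
  The \<open>k\<close>-th row belongs to the \<open>k\<close>-th weight vector and lists a certificate for each neighbour \<open>j\<close>.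
  Each row of coefficients solves the linear program that minimises their sum subject to each being
  at least one, scaled to coprime integers.
\<close>

definition adjacency_certificate_table :: "(nat \<times> int \<times> int list list) list list" where
  "adjacency_certificate_table =
   [[(3, 1, [[1, 1, 1, 1, 1, 2]]),
     (5, 1, [[2, 1, 1, 1, 1, 1]]),
     (7, 1, [[2, 1, 1, 1, 1, 1]]),
     (10, 1, [[1, 1, 1, 1, 1, 2]])],
    [(3, 1, [[1, 1, 1, 1, 1, 2]]),
     (4, 1, [[1, 1, 1, 1, 1, 2]]),
     (5, 1, [[1, 1, 1, 1, 1, 2]]),
     (9, 1, [[1, 1, 1, 1, 1, 2]])],
    [(1, -1, [[4, 3, 1, 1, 3, 3, 6],
        [3, 2, 1, 3, 2, 2, 1]]),
     (2, -1, [[3, 2, 1, 2, 2, 1, 3],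
        [1, 1, 1, 1, 1, 1, 1]]),
     (4, -1, [[3, 2, 1, 2, 2, 1, 3],
        [1, 1, 1, 1, 1, 1, 1]]),
     (5, -1, [[3, 2, 1, 2, 2, 1, 3],
        [1, 1, 1, 1, 1, 1, 1]]),
     (9, -1, [[3, 2, 1, 2, 2, 1, 3],
        [1, 1, 1, 1, 1, 1, 1]]),
     (10, -1, [[4, 3, 1, 1, 3, 3, 6],
        [3, 2, 1, 3, 2, 2, 1]]),
     (12, -1, [[3, 2, 1, 2, 2, 1, 3],
        [1, 1, 1, 1, 1, 1, 1]])],
    [(2, -1, [[6, 1, 1, 1, 1, 2, 6, 3]]),
     (3, -1, [[6, 1, 1, 1, 1, 2, 6, 3]]),
     (5, 1, [[6, 1, 1, 1, 1, 2, 6, 3]]),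
     (6, 1, [[6, 1, 1, 1, 1, 2, 6, 3]]),
     (12, 1, [[6, 1, 1, 1, 1, 2, 6, 3]]),
     (13, 1, [[1, 1, 1, 1, 2, 6, 6, 3]]),
     (18, 1, [[1, 1, 1, 1, 2, 6, 6, 3]])],
    [(1, -1, [[16, 1, 1, 10, 10, 1, 5, 5]]),
     (2, -1, [[5, 1, 1, 10, 10, 1, 5, 16]]),
     (3, -1, [[5, 1, 1, 10, 10, 1, 5, 16]]),
     (4, 1, [[5, 1, 1, 10, 10, 1, 5, 16]]),
     (6, 1, [[5, 1, 1, 10, 10, 1, 5, 16]]),
     (7, 1, [[16, 1, 1, 10, 10, 1, 5, 5]]),
     (12, 1, [[5, 1, 1, 10, 10, 1, 5, 16]])],
    [(4, 1, [[1, 1, 1, 1, 1, 2]]),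
     (5, 1, [[1, 1, 1, 1, 1, 2]]),
     (12, 1, [[1, 1, 1, 1, 1, 2]]),
     (15, 1, [[1, 1, 1, 1, 1, 2]])],
    [(1, -1, [[2, 1, 1, 1, 1, 1]]),
     (5, -1, [[2, 1, 1, 1, 1, 1]]),
     (12, 1, [[1, 1, 1, 1, 1, 2]]),
     (17, 1, [[1, 1, 1, 1, 1, 2]])],
    [(10, 1, [[3, 3, 1, 1, 1, 1, 1, 1, 1, 1, 1, 1, 4, 1],
        [3, 3, 1, 1, 1, 1, 1, 1, 1, 1, 1, 4, 1, 1],
        [3, 3, 1, 1, 1, 1, 1, 1, 1, 4, 1, 1, 1, 1]]),
     (11, -1, [[6, 4, 1, 1, 1, 1, 1, 4, 1, 1, 1, 1, 1, 4],
        [6, 4, 1, 1, 1, 1, 1, 4, 1, 1, 1, 4, 1, 1],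
        [3, 3, 1, 1, 1, 1, 1, 1, 1, 1, 1, 1, 4, 1]]),
     (13, 1, [[3, 3, 1, 1, 1, 1, 1, 1, 1, 1, 1, 1, 4, 1],
        [6, 4, 1, 1, 1, 4, 1, 1, 1, 1, 1, 1, 1, 4],
        [6, 4, 1, 1, 1, 4, 1, 1, 1, 1, 1, 4, 1, 1]]),
     (15, 1, [[4, 4, 1, 1, 1, 1, 4, 1, 1, 1, 1, 1, 6, 1],
        [4, 3, 1, 1, 1, 1, 1, 1, 1, 1, 1, 2, 2, 1],
        [4, 4, 1, 1, 1, 4, 1, 1, 1, 1, 1, 6, 1, 1]]),
     (16, 1, [[21, 22, 6, 6, 6, 15, 6, 6, 24, 30, 6, 6],
        [7, 6, 1, 1, 1, 6, 1, 1, 4, 12, 1, 1],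
        [7, 5, 3, 1, 1, 1, 1, 1, 6, 7, 1, 1],
        [7, 6, 6, 4, 2, 2, 2, 2, 5, 2, 2, 2],
        [7, 4, 5, 1, 1, 3, 1, 1, 1, 2, 1, 1]]),
     (19, 1, [[3, 3, 1, 1, 1, 1, 1, 1, 1, 1, 1, 1, 4, 1],
        [6, 4, 1, 1, 1, 4, 1, 1, 1, 1, 1, 1, 1, 4],
        [6, 4, 1, 1, 1, 4, 1, 1, 1, 1, 1, 4, 1, 1]])],
    [(2, 1, [[3, 1, 1, 6, 9, 7, 1, 1, 5, 1],
        [9, 1, 1, 15, 18, 16, 1, 1, 14, 1],
        [6, 4, 1, 6, 3, 1, 1, 1, 11, 1],
        [13, 5, 1, 1, 4, 2, 1, 1, 13, 1],
        [6, 2, 1, 2, 1, 3, 3, 1, 1, 1]]),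
     (3, 1, [[3, 1, 1, 6, 9, 7, 1, 1, 5, 1],
        [9, 1, 1, 15, 18, 16, 1, 1, 14, 1],
        [6, 4, 1, 6, 3, 1, 1, 1, 11, 1],
        [13, 5, 1, 1, 4, 2, 1, 1, 13, 1],
        [6, 2, 1, 2, 1, 3, 3, 1, 1, 1]]),
     (10, -1, [[5, 1, 1, 1, 1, 1, 1, 3, 1, 6, 3, 3, 1],
        [5, 1, 1, 1, 1, 1, 1, 3, 6, 1, 3, 3, 1]]),
     (14, -1, [[6, 1, 1, 1, 1, 1, 1, 1, 3, 1, 7, 1, 3],
        [6, 1, 1, 1, 1, 1, 3, 3, 5, 3, 1, 1, 1]]),
     (18, 1, [[2, 1, 1, 1, 1, 1, 1, 3, 5, 7, 1, 3, 1],
        [2, 1, 1, 1, 1, 1, 1, 5, 5, 7, 1, 1, 1]]),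
     (19, 1, [[6, 1, 1, 1, 1, 1, 1, 1, 3, 1, 7, 1, 3],
        [6, 1, 1, 1, 1, 1, 3, 3, 5, 3, 1, 1, 1]])],
    [(1, -1, [[10, 1, 1, 1, 1, 19, 15, 1, 1, 17, 17],
        [10, 3, 3, 3, 3, 27, 15, 3, 3, 21, 21],
        [16, 1, 7, 1, 1, 5, 1, 1, 1, 3, 19],
        [8, 1, 3, 1, 1, 1, 1, 1, 5, 3, 3],
        [14, 1, 5, 1, 1, 3, 13, 1, 1, 1, 1],
        [8, 1, 5, 1, 3, 1, 13, 1, 1, 7, 1]]),
     (3, 1, [[10, 3, 3, 15, 27, 3, 3, 21, 21, 3, 3],
        [10, 1, 1, 15, 19, 1, 1, 17, 17, 1, 1],
        [6, 3, 1, 3, 1, 1, 1, 5, 5, 1, 1],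
        [16, 7, 1, 1, 5, 1, 1, 3, 19, 1, 1],
        [7, 5, 1, 13, 3, 1, 1, 8, 1, 1, 1],
        [14, 5, 1, 13, 3, 1, 1, 1, 1, 1, 1]]),
     (8, 1, [[6, 1, 1, 1, 1, 1, 1, 4, 1, 1, 3, 2, 4, 1],
        [6, 1, 1, 1, 1, 1, 1, 4, 2, 2, 1, 5, 1, 1],
        [6, 1, 1, 1, 1, 1, 3, 2, 2, 6, 1, 1, 1, 1]]),
     (9, 1, [[5, 1, 1, 1, 1, 1, 1, 4, 1, 1, 4, 4, 2, 1],
        [7, 1, 1, 1, 1, 1, 1, 4, 4, 1, 1, 1, 1, 3],
        [7, 1, 1, 1, 1, 1, 4, 1, 4, 1, 1, 3, 1, 1]]),
     (11, -1, [[7, 1, 1, 1, 1, 1, 1, 4, 1, 4, 1, 1, 1, 3],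
        [7, 1, 1, 1, 1, 1, 1, 4, 4, 1, 1, 3, 1, 1],
        [5, 1, 1, 1, 1, 1, 4, 1, 1, 4, 1, 4, 2, 1]]),
     (14, 1, [[1, 1, 1, 1, 1, 1, 1, 1, 1, 1, 1, 1, 1, 1],
        [3, 2, 2, 2, 5, 2, 2, 2, 2, 5, 2, 2, 2, 2],
        [3, 1, 1, 1, 7, 1, 1, 1, 1, 7, 1, 1, 1, 1]]),
     (18, 1, [[3, 1, 1, 1, 1, 1, 4, 1, 1, 4, 1, 4, 4, 1],
        [9, 1, 1, 1, 1, 1, 1, 4, 1, 1, 4, 1, 1, 1],
        [3, 1, 1, 1, 1, 1, 4, 1, 4, 1, 1, 7, 1, 1]])],
    [(8, 1, [[10, 6, 3, 3, 3, 3, 3, 3, 3, 3, 3, 3, 3, 3, 3, 33, 3],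
        [5, 1, 1, 1, 1, 1, 1, 3, 1, 1, 1, 1, 1, 1, 1, 13, 1],
        [10, 1, 1, 1, 1, 1, 1, 18, 1, 1, 1, 1, 1, 1, 1, 28, 1],
        [60, 38, 9, 9, 9, 9, 9, 9, 9, 9, 39, 9, 9, 9, 9, 159, 9],
        [20, 2, 1, 1, 1, 1, 1, 1, 1, 1, 11, 1, 1, 1, 1, 31, 1],
        [60, 38, 9, 39, 9, 9, 9, 9, 9, 9, 9, 9, 9, 9, 9, 159, 9],
        [20, 2, 1, 11, 1, 1, 1, 1, 1, 1, 1, 1, 1, 1, 1, 31, 1]]),
     (10, 1, [[22, 9, 6, 15, 6, 6, 6, 6, 6, 6, 6, 6, 6, 6, 6, 72, 6],
        [11, 2, 2, 2, 4, 2, 2, 7, 2, 2, 2, 2, 2, 2, 2, 29, 2],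
        [11, 1, 1, 1, 2, 1, 1, 20, 1, 1, 1, 1, 1, 1, 1, 31, 1],
        [11, 4, 2, 2, 2, 7, 2, 2, 2, 2, 2, 2, 2, 2, 2, 29, 2],
        [11, 1, 1, 1, 1, 9, 1, 9, 1, 1, 1, 1, 1, 1, 1, 28, 1],
        [11, 2, 1, 1, 1, 20, 1, 1, 1, 1, 1, 1, 1, 1, 1, 31, 1],
        [33, 10, 3, 24, 3, 3, 3, 3, 3, 3, 3, 3, 3, 3, 3, 69, 3]]),
     (14, -1, [[20, 1, 1, 1, 1, 1, 1, 1, 1, 1, 2, 1, 1, 11, 1, 31, 1],
        [20, 1, 1, 1, 1, 1, 1, 1, 1, 1, 2, 11, 1, 1, 1, 31, 1],
        [10, 1, 1, 1, 1, 1, 1, 1, 1, 1, 1, 1, 18, 1, 1, 28, 1],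
        [60, 9, 9, 9, 9, 9, 9, 9, 9, 9, 38, 9, 9, 39, 9, 159, 9],
        [60, 9, 9, 9, 9, 9, 9, 9, 9, 9, 38, 39, 9, 9, 9, 159, 9],
        [5, 1, 1, 1, 1, 1, 1, 1, 1, 1, 1, 1, 3, 1, 1, 13, 1],
        [10, 3, 3, 3, 3, 3, 3, 3, 3, 3, 6, 3, 3, 3, 3, 33, 3]])],
    [(3, 1, [[1, 1, 1, 1, 1, 1, 1],
        [3, 1, 2, 2, 2, 3, 1]]),
     (4, 1, [[1, 1, 1, 1, 1, 1, 1],
        [3, 1, 2, 2, 2, 3, 1]]),
     (5, 1, [[1, 1, 1, 1, 1, 1, 1],
        [3, 1, 2, 2, 2, 3, 1]]),
     (6, 1, [[1, 1, 1, 1, 1, 1, 1],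
        [3, 1, 2, 2, 2, 3, 1]]),
     (7, 1, [[4, 1, 1, 3, 3, 3, 6],
        [3, 3, 1, 2, 2, 2, 1]]),
     (15, 1, [[1, 1, 1, 1, 1, 1, 1],
        [3, 1, 2, 2, 2, 3, 1]]),
     (17, 1, [[4, 1, 1, 3, 3, 3, 6],
        [3, 3, 1, 2, 2, 2, 1]])],
    [(4, 1, [[3, 1, 1, 1, 1, 8, 1, 8, 1, 3],
        [3, 1, 1, 4, 1, 5, 1, 8, 1, 3],
        [3, 1, 4, 1, 1, 8, 1, 5, 1, 3]]),
     (8, -1, [[2, 1, 1, 1, 1, 1, 1, 5, 1, 1, 5, 1]]),
     (18, 1, [[3, 1, 1, 1, 1, 8, 1, 8, 1, 3],
        [3, 1, 1, 4, 1, 5, 1, 8, 1, 3],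
        [3, 1, 4, 1, 1, 8, 1, 5, 1, 3]]),
     (19, 1, [[2, 1, 1, 1, 1, 1, 1, 5, 1, 1, 5, 1]])],
    [(9, 1, [[12, 11, 3, 3, 3, 3, 3, 3, 3, 3, 12, 3, 6, 3, 3, 3],
        [24, 16, 3, 3, 6, 3, 3, 3, 3, 3, 3, 12, 21, 3, 3, 3],
        [24, 16, 6, 3, 3, 3, 3, 3, 3, 12, 3, 3, 21, 3, 3, 3],
        [12, 11, 3, 12, 3, 6, 3, 3, 3, 3, 3, 3, 3, 3, 3, 3],
        [24, 16, 3, 3, 12, 21, 3, 3, 3, 3, 3, 6, 3, 3, 3, 3],
        [24, 16, 12, 3, 3, 21, 3, 3, 3, 6, 3, 3, 3, 3, 3, 3]]),
     (10, -1, [[6, 5, 1, 1, 1, 1, 1, 1, 1, 1, 1, 1, 1, 4, 7, 1, 1],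
        [6, 5, 1, 1, 1, 1, 1, 1, 1, 1, 7, 1, 1, 4, 1, 1, 1],
        [6, 5, 1, 1, 1, 1, 1, 1, 1, 1, 7, 4, 1, 1, 1, 1, 1],
        [6, 5, 1, 1, 1, 1, 1, 1, 1, 7, 1, 4, 1, 1, 1, 1, 1],
        [3, 3, 1, 1, 1, 1, 1, 1, 1, 1, 1, 1, 1, 1, 1, 1, 1]]),
     (11, 1, [[5, 5, 1, 8, 1, 1, 1, 6, 1, 1, 1, 1, 1, 1, 1],
        [15, 10, 3, 9, 3, 3, 3, 3, 3, 3, 3, 3, 3, 3, 3],
        [5, 5, 1, 8, 1, 6, 1, 1, 1, 1, 1, 1, 1, 1, 1],
        [20, 12, 2, 2, 12, 5, 2, 15, 2, 2, 2, 2, 2, 2, 2],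
        [10, 6, 1, 1, 6, 6, 4, 1, 1, 1, 1, 1, 1, 1, 1],
        [20, 12, 12, 2, 2, 5, 2, 15, 2, 2, 2, 2, 2, 2, 2],
        [10, 6, 6, 1, 1, 6, 4, 1, 1, 1, 1, 1, 1, 1, 1]]),
     (18, 1, [[18, 16, 3, 3, 3, 3, 12, 3, 3, 3, 21, 3, 3, 12, 3, 3],
        [18, 13, 3, 3, 3, 3, 3, 3, 3, 3, 12, 3, 12, 3, 3, 3],
        [18, 16, 3, 3, 3, 12, 3, 3, 3, 21, 3, 3, 12, 3, 3, 3],
        [18, 16, 3, 12, 3, 3, 21, 3, 3, 3, 12, 3, 3, 3, 3, 3],
        [18, 13, 3, 12, 3, 12, 3, 3, 3, 3, 3, 3, 3, 3, 3, 3],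
        [18, 16, 12, 3, 3, 21, 3, 3, 3, 12, 3, 3, 3, 3, 3, 3]])],
    [(6, 1, [[3, 1, 1, 7, 1, 6, 1, 5, 9, 1],
        [9, 1, 1, 16, 1, 15, 1, 14, 18, 1],
        [6, 4, 1, 1, 1, 6, 1, 11, 3, 1],
        [13, 5, 1, 2, 1, 1, 1, 13, 4, 1],
        [6, 2, 1, 3, 3, 2, 1, 1, 1, 1]]),
     (8, -1, [[6, 1, 1, 1, 1, 1, 1, 1, 7, 1, 1, 3, 3],
        [6, 1, 1, 1, 1, 1, 1, 5, 3, 1, 1, 5, 1]]),
     (12, 1, [[3, 1, 1, 7, 1, 6, 1, 5, 9, 1],
        [9, 1, 1, 16, 1, 15, 1, 14, 18, 1],
        [6, 4, 1, 1, 1, 6, 1, 11, 3, 1],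
        [13, 5, 1, 2, 1, 1, 1, 13, 4, 1],
        [6, 2, 1, 3, 3, 2, 1, 1, 1, 1]]),
     (17, 1, [[5, 1, 1, 1, 1, 3, 1, 1, 3, 3, 1, 1, 6],
        [5, 1, 1, 1, 1, 1, 1, 5, 3, 1, 1, 6, 1]]),
     (18, 1, [[2, 1, 1, 1, 1, 1, 7, 1, 1, 3, 3, 5, 1],
        [2, 1, 1, 1, 1, 1, 7, 1, 1, 5, 1, 5, 1]]),
     (20, 1, [[6, 1, 1, 1, 1, 1, 1, 1, 7, 1, 1, 3, 3],
        [6, 1, 1, 1, 1, 1, 1, 5, 3, 1, 1, 5, 1]])],
    [(8, -1, [[40, 2, 2, 2, 2, 2, 2, 25, 2, 2, 2, 45, 45, 51],
        [30, 3, 3, 3, 10, 3, 3, 3, 3, 3, 3, 33, 33, 42],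
        [20, 3, 3, 3, 20, 3, 3, 3, 3, 3, 3, 33, 33, 42],
        [10, 1, 1, 1, 1, 1, 1, 7, 1, 1, 2, 7, 7, 1],
        [7, 1, 1, 1, 2, 1, 1, 1, 1, 2, 1, 4, 4, 1]]),
     (18, 1, [[27, 5, 5, 5, 5, 5, 5, 5, 5, 5, 5, 5, 5, 5, 27, 14, 14, 14]]),
     (19, 1, [[20, 20, 3, 3, 3, 3, 3, 3, 3, 3, 3, 33, 33, 42],
        [30, 10, 3, 3, 3, 3, 3, 3, 3, 3, 3, 33, 33, 42],
        [40, 2, 25, 2, 2, 2, 2, 2, 2, 2, 2, 45, 45, 51],
        [7, 2, 1, 1, 1, 1, 1, 1, 1, 2, 1, 4, 4, 1],
        [10, 1, 7, 1, 1, 1, 1, 1, 2, 1, 1, 7, 7, 1]])],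
    [(7, 1, [[10, 3, 3, 27, 3, 21, 15, 3, 21, 3, 3],
        [10, 1, 1, 19, 1, 17, 15, 1, 17, 1, 1],
        [6, 3, 1, 1, 1, 5, 3, 1, 5, 1, 1],
        [7, 5, 1, 3, 1, 8, 13, 1, 1, 1, 1],
        [16, 7, 1, 5, 1, 3, 1, 1, 19, 1, 1],
        [14, 5, 1, 3, 1, 1, 13, 1, 1, 1, 1]]),
     (12, 1, [[10, 3, 3, 27, 3, 21, 15, 3, 21, 3, 3],
        [10, 1, 1, 19, 1, 17, 15, 1, 17, 1, 1],
        [6, 3, 1, 1, 1, 5, 3, 1, 5, 1, 1],
        [7, 5, 1, 3, 1, 8, 13, 1, 1, 1, 1],
        [16, 7, 1, 5, 1, 3, 1, 1, 19, 1, 1],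
        [14, 5, 1, 3, 1, 1, 13, 1, 1, 1, 1]]),
     (15, -1, [[7, 1, 1, 1, 1, 1, 1, 1, 1, 4, 1, 3, 4, 1],
        [7, 1, 1, 1, 1, 1, 4, 3, 1, 1, 1, 1, 4, 1],
        [5, 1, 1, 1, 1, 1, 1, 4, 4, 4, 2, 1, 1, 1]]),
     (18, 1, [[3, 1, 1, 1, 1, 1, 1, 7, 1, 2, 5, 2, 1, 1],
        [3, 1, 1, 1, 1, 1, 1, 7, 1, 5, 2, 2, 1, 1],
        [3, 1, 1, 1, 1, 1, 3, 5, 1, 5, 3, 1, 1, 1]]),
     (19, 1, [[1, 1, 1, 1, 1, 1, 1, 1, 1, 1, 1, 1, 1, 1],
        [3, 2, 2, 2, 2, 2, 2, 5, 2, 5, 2, 2, 2, 2],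
        [3, 1, 1, 1, 1, 1, 1, 7, 1, 7, 1, 1, 1, 1]]),
     (20, 1, [[6, 1, 1, 1, 1, 1, 1, 1, 1, 3, 4, 2, 4, 1],
        [6, 1, 1, 1, 1, 1, 2, 1, 2, 1, 4, 5, 1, 1],
        [6, 1, 1, 1, 1, 1, 2, 3, 6, 1, 2, 1, 1, 1]]),
     (21, 1, [[5, 1, 1, 1, 1, 1, 1, 1, 1, 4, 4, 4, 2, 1],
        [7, 1, 1, 1, 1, 1, 4, 1, 1, 1, 4, 1, 1, 3],
        [7, 1, 1, 1, 1, 1, 4, 4, 1, 3, 1, 1, 1, 1]])],
    [(4, 1, [[4, 1, 1, 1, 1, 1, 1, 11, 18, 1, 16, 11, 1, 1, 1],
        [6, 1, 1, 1, 1, 1, 1, 11, 24, 1, 22, 11, 1, 1, 1],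
        [12, 1, 1, 1, 1, 1, 1, 11, 42, 1, 40, 11, 1, 1, 1],
        [12, 1, 1, 1, 1, 1, 1, 23, 30, 1, 28, 23, 1, 1, 1],
        [6, 1, 1, 1, 1, 1, 1, 5, 6, 1, 10, 5, 1, 1, 1],
        [12, 1, 3, 1, 1, 1, 1, 1, 10, 1, 8, 13, 1, 1, 1],
        [14, 1, 1, 1, 3, 1, 1, 1, 8, 1, 20, 1, 1, 1, 1],
        [19, 1, 1, 1, 3, 1, 1, 15, 3, 6, 1, 1, 1, 1, 1]]),
     (9, -1, [[12, 1, 1, 1, 1, 1, 1, 1, 1, 1, 1, 1, 1, 1, 15, 1, 17, 7, 5],
        [18, 1, 1, 1, 1, 1, 1, 1, 1, 1, 1, 1, 1, 9, 1, 7, 11, 11, 1],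
        [18, 1, 1, 1, 1, 1, 1, 1, 1, 1, 1, 1, 9, 1, 19, 7, 3, 1, 1],
        [18, 1, 1, 1, 1, 1, 1, 1, 1, 1, 1, 1, 9, 19, 1, 7, 3, 1, 1]]),
     (10, -1, [[18, 1, 1, 1, 1, 1, 1, 1, 1, 1, 1, 1, 7, 1, 1, 1, 19, 9, 3],
        [18, 1, 1, 1, 1, 1, 1, 1, 1, 1, 1, 1, 7, 1, 1, 17, 3, 11, 1],
        [18, 1, 1, 1, 1, 1, 1, 1, 1, 1, 1, 1, 7, 1, 19, 1, 1, 9, 3],
        [18, 1, 1, 1, 1, 1, 1, 1, 1, 1, 1, 1, 7, 17, 3, 1, 1, 11, 1]]),
     (13, 1, [[4, 1, 1, 1, 1, 1, 1, 11, 18, 1, 16, 11, 1, 1, 1],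
        [6, 1, 1, 1, 1, 1, 1, 11, 24, 1, 22, 11, 1, 1, 1],
        [12, 1, 1, 1, 1, 1, 1, 11, 42, 1, 40, 11, 1, 1, 1],
        [12, 1, 1, 1, 1, 1, 1, 23, 30, 1, 28, 23, 1, 1, 1],
        [6, 1, 1, 1, 1, 1, 1, 5, 6, 1, 10, 5, 1, 1, 1],
        [12, 1, 3, 1, 1, 1, 1, 1, 10, 1, 8, 13, 1, 1, 1],
        [14, 1, 1, 1, 3, 1, 1, 1, 8, 1, 20, 1, 1, 1, 1],
        [19, 1, 1, 1, 3, 1, 1, 15, 3, 6, 1, 1, 1, 1, 1]]),
     (14, -1, [[20, 1, 1, 1, 1, 1, 1, 1, 1, 1, 1, 1, 1, 1, 7, 1, 17, 7, 5],
        [20, 1, 1, 1, 1, 1, 1, 1, 1, 1, 1, 1, 1, 1, 7, 17, 1, 11, 1],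
        [20, 1, 1, 1, 1, 1, 1, 1, 1, 1, 1, 1, 11, 1, 17, 7, 1, 1, 1],
        [20, 1, 1, 1, 1, 1, 1, 1, 1, 1, 1, 5, 7, 17, 1, 7, 1, 1, 1]]),
     (15, 1, [[12, 1, 1, 1, 1, 1, 1, 1, 1, 1, 1, 1, 17, 1, 7, 15, 5, 1, 1],
        [12, 1, 1, 1, 1, 1, 1, 1, 1, 1, 1, 3, 15, 7, 1, 19, 1, 1, 1],
        [12, 1, 1, 1, 1, 1, 1, 1, 1, 1, 1, 1, 17, 9, 11, 7, 1, 1, 1],
        [12, 1, 1, 1, 1, 1, 1, 1, 1, 1, 1, 3, 15, 19, 1, 7, 1, 1, 1]]),
     (16, 1, [[3, 1, 1, 1, 1, 1, 1, 1, 1, 1, 1, 1, 8, 18, 15, 1, 11, 1, 1, 1],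
        [3, 1, 1, 1, 1, 1, 1, 1, 1, 1, 1, 1, 8, 18, 18, 1, 8, 1, 1, 1],
        [3, 1, 1, 1, 1, 1, 1, 1, 1, 1, 1, 1, 11, 15, 18, 1, 8, 1, 1, 1]]),
     (17, 1, [[12, 1, 1, 1, 1, 1, 1, 1, 1, 1, 1, 1, 1, 15, 1, 7, 19, 3, 1],
        [12, 1, 1, 1, 1, 1, 1, 1, 1, 1, 1, 1, 1, 15, 1, 19, 7, 3, 1],
        [18, 1, 1, 1, 1, 1, 1, 1, 1, 1, 1, 1, 11, 11, 7, 1, 9, 1, 1],
        [18, 1, 1, 1, 1, 1, 1, 1, 1, 1, 1, 11, 1, 11, 7, 9, 1, 1, 1]]),
     (20, 1, [[20, 1, 1, 1, 1, 1, 1, 1, 1, 1, 1, 1, 1, 1, 7, 1, 17, 7, 5],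
        [20, 1, 1, 1, 1, 1, 1, 1, 1, 1, 1, 1, 1, 1, 7, 17, 1, 11, 1],
        [20, 1, 1, 1, 1, 1, 1, 1, 1, 1, 1, 1, 11, 1, 17, 7, 1, 1, 1],
        [20, 1, 1, 1, 1, 1, 1, 1, 1, 1, 1, 5, 7, 17, 1, 7, 1, 1, 1]])],
    [(8, -1, [[6, 4, 1, 1, 1, 1, 1, 1, 1, 1, 4, 1, 4, 1],
        [6, 4, 1, 1, 1, 4, 1, 1, 1, 1, 1, 1, 4, 1],
        [3, 3, 1, 1, 1, 1, 1, 1, 1, 4, 1, 1, 1, 1]]),
     (9, -1, [[4, 4, 1, 1, 1, 1, 1, 1, 1, 1, 1, 4, 1, 6],
        [5, 3, 1, 1, 1, 2, 1, 1, 1, 1, 1, 1, 1, 1],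
        [4, 4, 1, 1, 1, 1, 1, 4, 1, 6, 1, 1, 1, 1]]),
     (13, -1, [[6, 4, 1, 1, 1, 1, 1, 1, 1, 1, 4, 1, 4, 1],
        [6, 4, 1, 1, 1, 4, 1, 1, 1, 1, 1, 1, 4, 1],
        [3, 3, 1, 1, 1, 1, 1, 1, 1, 4, 1, 1, 1, 1]]),
     (16, 1, [[21, 22, 15, 6, 6, 24, 6, 6, 6, 30, 6, 6],
        [7, 5, 1, 1, 1, 6, 3, 1, 1, 7, 1, 1],
        [7, 6, 2, 4, 2, 5, 6, 2, 2, 2, 2, 2],
        [7, 6, 6, 1, 1, 4, 1, 1, 1, 12, 1, 1],
        [7, 4, 3, 1, 1, 1, 5, 1, 1, 2, 1, 1]]),
     (17, 1, [[3, 3, 1, 1, 1, 1, 1, 1, 1, 1, 1, 1, 4, 1],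
        [3, 3, 1, 1, 1, 1, 1, 1, 1, 1, 1, 4, 1, 1],
        [3, 3, 1, 1, 1, 1, 1, 4, 1, 1, 1, 1, 1, 1]]),
     (21, 1, [[3, 3, 1, 1, 1, 1, 1, 1, 1, 1, 1, 1, 4, 1],
        [6, 4, 1, 4, 1, 1, 1, 1, 1, 1, 1, 1, 1, 4],
        [6, 4, 1, 4, 1, 1, 1, 1, 4, 1, 1, 1, 1, 1]])],
    [(15, 1, [[12, 11, 3, 3, 3, 12, 3, 3, 3, 6, 3, 3, 3, 3, 3, 3],
        [12, 11, 3, 3, 12, 3, 3, 3, 6, 3, 3, 3, 3, 3, 3, 3],
        [24, 16, 3, 3, 3, 3, 6, 12, 3, 21, 3, 3, 3, 3, 3, 3],
        [24, 16, 3, 3, 3, 3, 12, 6, 21, 3, 3, 3, 3, 3, 3, 3],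
        [24, 16, 6, 12, 3, 3, 3, 3, 3, 21, 3, 3, 3, 3, 3, 3],
        [24, 16, 12, 6, 3, 3, 3, 3, 21, 3, 3, 3, 3, 3, 3, 3]]),
     (17, 1, [[3, 3, 1, 1, 1, 1, 1, 1, 1, 1, 1, 1, 1, 1, 1, 1, 1],
        [6, 5, 1, 1, 1, 1, 1, 1, 4, 1, 1, 7, 1, 1, 1, 1, 1],
        [6, 5, 1, 1, 1, 1, 1, 1, 4, 1, 7, 1, 1, 1, 1, 1, 1],
        [6, 5, 1, 4, 1, 1, 1, 1, 1, 1, 7, 1, 1, 1, 1, 1, 1],
        [6, 5, 1, 4, 1, 7, 1, 1, 1, 1, 1, 1, 1, 1, 1, 1, 1]]),
     (18, 1, [[18, 16, 3, 3, 3, 21, 3, 3, 3, 3, 12, 12, 3, 3, 3, 3],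
        [18, 16, 3, 3, 12, 12, 3, 3, 3, 3, 21, 3, 3, 3, 3, 3],
        [18, 13, 3, 3, 3, 12, 3, 3, 3, 12, 3, 3, 3, 3, 3, 3],
        [18, 13, 3, 3, 12, 3, 3, 3, 12, 3, 3, 3, 3, 3, 3, 3],
        [18, 16, 3, 21, 3, 3, 3, 3, 12, 12, 3, 3, 3, 3, 3, 3],
        [18, 16, 12, 12, 3, 3, 3, 3, 21, 3, 3, 3, 3, 3, 3, 3]]),
     (21, 1, [[5, 5, 1, 1, 6, 1, 1, 1, 1, 1, 1, 8, 1, 1, 1],
        [15, 10, 3, 3, 3, 3, 3, 3, 3, 3, 3, 9, 3, 3, 3],
        [5, 5, 6, 1, 1, 1, 1, 1, 1, 1, 1, 8, 1, 1, 1],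
        [20, 12, 5, 2, 15, 2, 2, 2, 2, 2, 2, 2, 2, 12, 2],
        [10, 6, 6, 4, 1, 1, 1, 1, 1, 1, 1, 1, 1, 6, 1],
        [20, 12, 5, 2, 15, 2, 2, 12, 2, 2, 2, 2, 2, 2, 2],
        [10, 6, 6, 4, 1, 1, 1, 6, 1, 1, 1, 1, 1, 1, 1]])],
    [(17, 1, [[22, 9, 6, 15, 6, 6, 6, 6, 6, 6, 6, 6, 6, 6, 6, 72, 6],
        [11, 2, 2, 2, 4, 2, 2, 7, 2, 2, 2, 2, 2, 2, 2, 29, 2],
        [11, 1, 1, 1, 2, 1, 1, 20, 1, 1, 1, 1, 1, 1, 1, 31, 1],
        [11, 4, 2, 2, 2, 7, 2, 2, 2, 2, 2, 2, 2, 2, 2, 29, 2],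
        [11, 1, 1, 1, 1, 9, 1, 9, 1, 1, 1, 1, 1, 1, 1, 28, 1],
        [11, 2, 1, 1, 1, 20, 1, 1, 1, 1, 1, 1, 1, 1, 1, 31, 1],
        [33, 10, 3, 24, 3, 3, 3, 3, 3, 3, 3, 3, 3, 3, 3, 69, 3]]),
     (19, -1, [[20, 1, 1, 1, 1, 1, 1, 1, 1, 1, 2, 1, 1, 11, 1, 31, 1],
        [20, 1, 1, 1, 1, 1, 1, 1, 1, 1, 2, 11, 1, 1, 1, 31, 1],
        [10, 1, 1, 1, 1, 1, 1, 1, 1, 1, 1, 1, 18, 1, 1, 28, 1],
        [60, 9, 9, 9, 9, 9, 9, 9, 9, 9, 38, 9, 9, 39, 9, 159, 9],
        [60, 9, 9, 9, 9, 9, 9, 9, 9, 9, 38, 39, 9, 9, 9, 159, 9],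
        [5, 1, 1, 1, 1, 1, 1, 1, 1, 1, 1, 1, 3, 1, 1, 13, 1],
        [10, 3, 3, 3, 3, 3, 3, 3, 3, 3, 6, 3, 3, 3, 3, 33, 3]]),
     (20, 1, [[10, 6, 3, 3, 3, 3, 3, 3, 3, 3, 3, 3, 3, 3, 3, 33, 3],
        [5, 1, 1, 1, 1, 1, 1, 3, 1, 1, 1, 1, 1, 1, 1, 13, 1],
        [10, 1, 1, 1, 1, 1, 1, 18, 1, 1, 1, 1, 1, 1, 1, 28, 1],
        [60, 38, 9, 9, 9, 9, 9, 9, 9, 9, 39, 9, 9, 9, 9, 159, 9],
        [20, 2, 1, 1, 1, 1, 1, 1, 1, 1, 11, 1, 1, 1, 1, 31, 1],
        [60, 38, 9, 39, 9, 9, 9, 9, 9, 9, 9, 9, 9, 9, 9, 159, 9],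
        [20, 2, 1, 11, 1, 1, 1, 1, 1, 1, 1, 1, 1, 1, 1, 31, 1]])]]"

text \<open>
  The \<open>k\<close>-th row lists some \<open>j\<close> that \<open>k\<close> does not lead to. For a non-adjacent pair one direction is
  enough to list; where both fail, it is listed at the vector that vanishes on fewer exponents.
  Each witness spans the weights, modulo the \<open>k\<close>-th vector, that vanish on some rank-four set of
  the exponents of \<open>k\<close>: every maximal slice is cut out by a weight of this kind, so a larger slice,
  if there is any, can be found among finitely many weights.
\<close>

definition nonadjacency_witnesses :: "(nat \<times> int list \<times> int list) list list" where
  "nonadjacency_witnesses =
   [[(4, [0, 0, 0, 1, -1, 0, 0], [0, -1, 0, 1, 0, 0, 0]),
     (9, [0, 0, 0, 1, -1, 0, 0], [0, -1, 0, 1, 0, 0, 0]),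
     (12, [0, 0, 0, 1, -1, 0, 0], [0, -1, 0, 1, -2, 0, 2]),
     (17, [0, 0, 0, 1, -1, 0, 0], [0, -1, 0, 1, -2, 0, 2]),
     (18, [0, -1, -2, 3, -2, 0, 2], [0, -1, 0, 1, 0, 0, 0]),
     (20, [0, 0, 0, 1, -1, 0, 0], [0, -1, 0, 1, -2, 0, 2])],
    [(1, [0, -1, 2, 1, -1, 0, -1], [0, 0, 1, 0, 0, 0, -1]),
     (12, [0, 0, 1, 1, 0, -1, -1], [0, 1, -2, -1, 1, 0, 1]),
     (15, [0, 0, 1, 1, 0, -1, -1], [0, 1, -2, -1, 1, 0, 1]),
     (17, [0, 0, 1, 0, 0, 0, -1], [0, 1, -2, -1, 1, 0, 1]),
     (21, [0, 0, 1, 0, 0, 0, -1], [0, 0, 1, 1, 0, -1, -1])],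
    [(16, [0, 1, -1, 0, 0, 0, 0], [0, -2, 1, -1, 1, 0, 1]),
     (17, [0, 0, 1, 0, 0, 0, -1], [0, -1, 1, 0, 0, 0, 0]),
     (18, [0, 1, -1, 0, 0, 0, 0], [0, -2, 1, -1, 1, 0, 1]),
     (20, [0, -2, 3, 1, 1, -2, -1], [0, -2, 1, -1, 1, 0, 1]),
     (21, [0, 0, 0, 1, 0, 0, -1], [0, -1, 1, 0, 0, 0, 0])],
    [(11, [0, 1, -1, 0, 1, -1, 0], [0, 0, 1, 0, 0, 0, -1]),
     (16, [0, 1, -1, 0, 1, -1, 0], [0, -1, 1, 0, -1, 1, 0]),
     (21, [0, 0, 1, 0, 0, 0, -1], [0, -1, 0, 0, 0, 0, 1])],
    [(9, [0, 0, -1, 0, 1, 0, 0], [0, -2, 1, 2, 1, 0, -2]),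
     (10, [0, 0, -1, 0, 1, 0, 0], [0, -2, 1, 2, 1, 0, -2]),
     (15, [0, 2, 5, 4, -1, -6, -4], [0, 0, 1, 0, -1, 0, 0]),
     (17, [0, 2, 0, 3, -1, 0, -4], [0, 0, -1, 0, 1, 0, 0]),
     (18, [0, 0, -1, 0, 1, 0, 0], [0, 0, 1, 0, -1, 0, 0])],
    [(1, [0, -1, 1, -2, 2, -2, 2], [0, 2, 3, 4, 1, -6, -4]),
     (2, [0, -1, 1, -2, -3, 3, 2], [0, -1, 1, 3, 2, -2, -3]),
     (3, [0, -1, 1, -2, 2, -2, 2], [0, -1, 1, 3, 2, -2, -3]),
     (9, [0, -1, 1, -2, -3, 3, 2], [0, -1, 1, -2, 2, -2, 2]),
     (10, [0, -1, 1, -2, -3, 3, 2], [0, -1, 1, 3, 2, -2, -3]),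
     (11, [0, -1, 1, -2, 2, -2, 2], [0, 2, 3, 4, 1, -6, -4])],
    [(2, [0, -2, -4, 1, 1, 0, 4], [0, 0, -1, 1, 0, 0, 0]),
     (3, [0, -2, -4, 1, 1, 0, 4], [0, 0, -1, 1, 0, 0, 0]),
     (4, [0, 0, 0, 1, 0, -1, 0], [0, 0, -1, 1, 0, 0, 0]),
     (6, [0, 0, 0, 1, 0, -1, 0], [0, 0, -1, 1, 0, 0, 0]),
     (10, [0, -1, -2, 2, -1, 0, 2], [0, 0, -1, 1, 0, 0, 0]),
     (14, [0, -2, -4, 1, 1, 0, 4], [0, 0, -1, 1, 0, 0, 0]),
     (15, [0, 0, 0, 1, 0, -1, 0], [0, 0, -1, 1, 0, 0, 0]),
     (18, [0, 0, 0, 1, 0, -1, 0], [0, -2, -1, 1, 1, 0, 1])],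
    [(1, [0, 0, 1, -1, 0, 0, 0], [0, 0, 0, 0, -1, 0, 1]),
     (2, [0, 0, 1, -1, 0, 0, 0], [0, -1, 1, 0, 0, 0, 0]),
     (3, [0, 0, 1, -1, 0, 0, 0], [0, -1, 1, 0, 0, 0, 0]),
     (4, [0, 1, 0, 0, 0, 0, -1], [0, -1, 1, 0, 0, 0, 0]),
     (5, [0, 1, 0, 0, 0, 0, -1], [0, 0, 0, 0, -1, 0, 1]),
     (6, [0, 1, 0, 0, 0, 0, -1], [0, 0, 1, -1, 0, 0, 0]),
     (7, [0, 1, 0, 0, 0, 0, -1], [0, 0, 1, -1, 0, 0, 0]),
     (12, [0, 1, 0, 0, 0, 0, -1], [0, 0, 1, -1, 0, 0, 0]),
     (14, [0, 0, 1, -1, 0, 0, 0], [0, -1, 1, 0, 0, 0, 0]),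
     (18, [0, 1, 1, 0, 2, -2, -2], [0, -1, 1, 0, 0, 0, 0]),
     (20, [0, 1, 1, 0, 0, 0, -2], [0, 0, 1, -1, 0, 0, 0]),
     (21, [0, 1, 0, 0, 0, 0, -1], [0, -1, 1, 0, 0, -2, 2])],
    [(4, [0, 0, 0, 0, 1, -1, 0], [0, 0, -1, 0, 0, 0, 1]),
     (7, [0, -1, 0, 0, 1, 0, 0], [0, 0, -1, 0, 0, 0, 1]),
     (8, [0, -1, 0, 0, 0, 0, 1], [0, 0, -1, 0, 0, 0, 1]),
     (11, [0, -1, 0, 0, 1, 0, 0], [0, 1, 0, 0, 0, 0, -1]),
     (12, [0, 0, 0, 0, 1, -1, 0], [0, 0, -1, 0, 0, 0, 1]),
     (13, [0, -1, 0, 0, 0, 0, 1], [0, 0, -1, 0, 0, 0, 1]),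
     (16, [0, -2, 0, 0, 1, 1, 0], [0, 0, 0, 0, -1, 1, 0]),
     (17, [0, 0, 0, 0, 1, -1, 0], [0, 0, 0, 0, -1, 1, 0]),
     (20, [0, 1, 0, 0, 0, -1, 0], [0, 0, 0, 0, -1, 1, 0]),
     (21, [0, 0, 1, 0, 0, 0, -1], [0, 1, 0, 0, 0, -1, 0])],
    [(2, [0, 0, 1, 0, 0, 0, -1], [0, 0, 0, 0, -1, 0, 1]),
     (4, [0, 0, 1, 0, 0, 0, -1], [0, 1, -1, 0, 0, 0, 0]),
     (13, [0, 1, 0, 0, 0, 0, -1], [0, 1, -1, 0, 0, 0, 0]),
     (16, [0, -1, 0, 0, 1, 1, -1], [0, -1, 0, 0, -1, 1, 1]),
     (20, [0, 1, 0, 0, 0, 0, -1], [0, 1, -1, 0, 0, 0, 0]),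
     (21, [0, 0, 0, 1, 0, 0, -1], [0, -1, 0, 0, 0, 0, 1])],
    [(1, [0, 0, 0, 0, 1, 0, -1], [0, -1, 0, 0, 1, 0, 0]),
     (2, [0, 0, 0, 0, 1, 0, -1], [0, -1, 0, 0, 1, 0, 0]),
     (3, [0, 0, 0, 0, 1, 0, -1], [0, 0, -2, 1, 1, 0, 0]),
     (5, [0, 0, 0, 0, 1, 0, -1], [0, 0, -1, 0, 1, 0, 0]),
     (7, [0, 0, 0, 0, 1, 0, -1], [0, 0, -1, 0, 1, 0, 0]),
     (16, [0, 0, 0, 0, 0, 1, -1], [0, -1, 1, 0, 0, 0, 0])],
    [(10, [0, 0, 0, 0, -1, 1, 0], [0, 0, 1, 0, 0, 0, -1]),
     (11, [0, 0, 0, 0, 1, -1, 0], [0, 2, 4, 1, -1, -2, -4]),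
     (14, [0, -2, -4, 2, 1, -1, 4], [0, -2, 2, 2, 1, -1, -2]),
     (16, [0, -2, -4, 2, 1, -1, 4], [0, 0, 0, 0, -1, 1, 0]),
     (18, [0, -2, -4, 2, 1, -1, 4], [0, 0, 0, 0, -1, 1, 0])],
    [(1, [0, 1, -1, 0, 0, 0, 0], [0, 1, 1, 0, 0, 0, -2]),
     (2, [0, 1, -1, 0, 0, 0, 0], [0, 0, 1, 0, -1, 0, 0]),
     (3, [0, 1, -1, 0, 0, 0, 0], [0, 1, 1, 2, -2, 0, -2]),
     (5, [0, 1, -1, 2, 0, 0, -2], [0, 1, 1, 2, -2, 0, -2]),
     (6, [0, 0, -1, 0, 1, 0, 0], [0, 0, 0, 0, -1, 1, 0]),
     (7, [0, 1, 0, 0, 0, 0, -1], [0, 0, 0, 0, -1, 1, 0]),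
     (11, [0, 0, -1, 0, 1, 0, 0], [0, 1, 1, 0, 0, 0, -2]),
     (12, [0, 1, -1, 2, 0, 0, -2], [0, 0, 0, 0, -1, 1, 0]),
     (16, [0, 1, -1, 2, 0, 0, -2], [0, 1, 1, 2, -2, 0, -2]),
     (21, [0, 1, 0, 0, 0, 0, -1], [0, 0, 1, 0, 0, -1, 0])],
    [(1, [0, -1, 0, 1, 0, 0, 0], [0, 1, -1, 0, 0, 0, 0]),
     (2, [0, 0, 0, 1, 0, 0, -1], [0, 1, -1, 0, 0, 0, 0]),
     (3, [0, -1, 0, 1, 1, 0, -1], [0, 1, -1, 0, 0, 0, 0]),
     (4, [0, 0, 0, 1, 0, 0, -1], [0, 1, -1, 0, 0, 0, 0]),
     (5, [0, 0, 0, 1, 0, 0, -1], [0, 1, -1, 0, 0, 0, 0]),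
     (6, [0, 0, 0, 1, 0, 0, -1], [0, 1, -1, 0, 0, 0, 0]),
     (13, [0, 0, 0, 1, 0, 0, -1], [0, 1, -1, 0, 0, 0, 0]),
     (16, [0, -2, 0, 1, 1, 1, -1], [0, 0, 0, -1, -1, 1, 1]),
     (21, [0, 1, 0, 0, 0, 0, -1], [0, -1, 0, 0, 0, 0, 1])],
    [(1, [0, 0, -1, -1, -1, 2, 1], [0, 0, 1, 0, 0, -1, 0]),
     (3, [0, -1, -1, -2, 0, 2, 2], [0, -1, 1, 0, 0, 0, 0]),
     (4, [0, 0, 0, 0, -1, 1, 0], [0, -1, 1, 0, 0, 0, 0]),
     (9, [0, 1, -1, 0, 0, 0, 0], [0, -1, 1, 0, 0, 0, 0]),
     (10, [0, 1, -1, 0, 0, 0, 0], [0, -1, 1, 0, 0, 0, 0]),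
     (11, [0, -1, 1, 0, 0, 0, 0], [0, 1, 1, 0, 0, 0, -2]),
     (13, [0, -1, -1, 0, -2, 2, 2], [0, -1, -1, 0, 0, 0, 2]),
     (14, [0, 1, -1, 0, 0, 0, 0], [0, -1, 1, 0, 0, 0, 0]),
     (16, [0, 1, -1, 0, 0, 0, 0], [0, 1, 1, 0, 0, -2, 0]),
     (19, [0, 0, 0, 0, -1, 1, 0], [0, -1, -1, 0, 0, 0, 2]),
     (21, [0, 1, 0, 0, 0, 0, -1], [0, 0, 1, 0, 0, -1, 0])],
    [(1, [0, -1, 1, 0, -2, 0, 2], [0, 1, -3, 2, 2, 0, -2]),
     (2, [0, 0, 1, 0, -1, 0, 0], [0, -1, 0, 0, 0, 1, 0]),
     (5, [0, 1, 2, 2, -3, 0, -2], [0, 1, -3, 2, 2, 0, -2]),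
     (6, [0, 1, 0, 0, 0, -1, 0], [0, 0, -1, 0, 1, 0, 0]),
     (7, [0, 1, 2, 2, -3, 0, -2], [0, -1, -2, 0, 1, 0, 2])],
    [(4, [0, 0, 0, 0, -1, 1, 0], [0, 0, 1, 0, 0, 0, -1]),
     (6, [0, 0, -1, 0, 0, 0, 1], [0, 1, 1, 0, 0, 0, -2]),
     (8, [0, 0, 0, 0, -1, 1, 0], [0, 1, 1, 0, 0, 0, -2]),
     (10, [0, 0, 0, 0, -1, 1, 0], [0, 0, 1, 0, 0, 0, -1]),
     (11, [0, -1, 0, 0, 0, 0, 1], [0, 1, 1, 0, 0, -1, -1]),
     (13, [0, 0, 0, 0, -1, 1, 0], [0, 1, 1, 0, 0, 0, -2]),
     (14, [0, 0, 0, -1, 0, 1, 0], [0, -1, 0, 0, 0, 1, 0]),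
     (16, [0, 0, -1, 0, 0, 0, 1], [0, 1, 1, 0, 0, -1, -1])],
    [(2, [0, -1, 1, 0, -1, 1, 0], [0, 1, 0, 0, 0, -1, 0]),
     (6, [0, -1, 0, 0, 0, 1, 0], [0, 1, -1, 0, 1, -1, 0]),
     (11, [0, -1, 0, 0, 1, 0, 0], [0, 1, 0, 0, 0, 0, -1]),
     (21, [0, 1, 0, 0, 0, 0, -1], [0, -1, 0, 0, 0, 0, 1])],
    [(1, [0, 0, 0, -1, 0, 1, 0], [0, 1, 1, 0, 0, 0, -2]),
     (2, [0, 0, 0, -1, 0, 1, 0], [0, 0, 1, 0, 0, 0, -1]),
     (3, [0, 0, 0, -1, 0, 1, 0], [0, 0, 1, 0, 0, 0, -1]),
     (4, [0, 0, 0, 0, 1, -1, 0], [0, 0, 1, 0, 0, 0, -1]),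
     (5, [0, 0, -1, 0, 0, 0, 1], [0, 1, 1, 0, 0, 0, -2]),
     (6, [0, 0, 0, 0, 1, -1, 0], [0, 0, 0, -1, 0, 1, 0]),
     (7, [0, 0, -1, 0, 0, 0, 1], [0, 0, 0, -1, 0, 1, 0]),
     (10, [0, 0, -1, 0, 0, 0, 1], [0, 0, 1, 0, 0, 0, -1]),
     (11, [0, -1, -1, 0, 1, 0, 1], [0, 1, 1, 0, 0, 0, -2]),
     (12, [0, 0, 0, 0, 1, -1, 0], [0, 0, 0, -1, 0, 1, 0]),
     (14, [0, 0, 0, -1, 0, 1, 0], [0, 0, 1, 0, 0, 0, -1]),
     (18, [0, 0, 0, 0, 1, -1, 0], [0, 0, 1, 0, 0, 0, -1]),
     (20, [0, 0, 0, 0, 1, -1, 0], [0, 0, 0, -1, 0, 1, 0])],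
    [(2, [0, 0, 0, 1, -1, 0, 0], [0, 0, 1, 1, 0, -1, -1]),
     (4, [0, 0, 0, 1, -1, 0, 0], [0, 0, 1, 1, 0, -1, -1]),
     (5, [0, 0, 0, 1, -1, 0, 0], [0, 1, 1, 1, 0, -2, -1]),
     (6, [0, 0, 0, 1, -1, 0, 0], [0, 1, 1, 1, 0, -2, -1]),
     (7, [0, 0, 0, 1, -1, 0, 0], [0, 0, 0, 1, 0, -1, 0]),
     (11, [0, -1, -1, 0, 0, 1, 1], [0, 1, 1, 1, 0, -1, -2]),
     (12, [0, 0, 0, 1, -1, 0, 0], [0, 0, 1, 1, 0, -2, 0]),
     (13, [0, 0, 0, 1, -1, 0, 0], [0, 0, 0, 1, 0, -1, 0]),
     (14, [0, 0, 0, 1, -1, 0, 0], [0, -1, 0, 1, 0, 0, 0]),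
     (16, [0, 0, -1, -1, 0, 1, 1], [0, 1, 1, 1, 0, -2, -1])],
    [(1, [0, 0, 1, 0, -1, 0, 0], [0, 1, 0, 0, 0, 0, -1]),
     (5, [0, 0, 1, 0, -1, 0, 0], [0, 1, 0, 0, 0, 0, -1]),
     (6, [0, 0, 1, 0, 0, -1, 0], [0, 1, 0, 0, 0, 0, -1]),
     (7, [0, 0, 1, 0, 0, -1, 0], [0, 1, 0, 0, 0, 0, -1]),
     (11, [0, 0, 0, 0, 1, -1, 0], [0, 1, 0, 0, 0, 0, -1]),
     (12, [0, 0, 1, 1, -2, 0, 0], [0, 1, 0, 0, 0, 0, -1]),
     (16, [0, 0, 0, 0, 1, -1, 0], [0, 1, 0, 0, 0, 0, -1])]]"

definition neighbor_table :: "nat list list" where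
  "neighbor_table =
    [[3, 5, 7, 10],
     [3, 4, 5, 9],
     [1, 2, 4, 5, 9, 10, 12],
     [2, 3, 5, 6, 12, 13, 18],
     [1, 2, 3, 4, 6, 7, 12],
     [4, 5, 12, 15],
     [1, 5, 12, 17],
     [10, 11, 13, 15, 16, 19],
     [2, 3, 10, 14, 18, 19],
     [1, 3, 8, 9, 11, 14, 18],
     [8, 10, 14],
     [3, 4, 5, 6, 7, 15, 17],
     [4, 8, 18, 19],
     [9, 10, 11, 18],
     [6, 8, 12, 17, 18, 20],
     [8, 18, 19],
     [7, 12, 15, 18, 19, 20, 21],
     [4, 9, 10, 13, 14, 15, 16, 17, 20],
     [8, 9, 13, 16, 17, 21],
     [15, 17, 18, 21],
     [17, 19, 20]]"

definition nonneighbor_table :: "nat list list" where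
  "nonneighbor_table =
    [[4, 9, 12, 17, 18, 20],
     [1, 12, 15, 17, 21],
     [16, 17, 18, 20, 21],
     [11, 16, 21],
     [9, 10, 15, 17, 18],
     [1, 2, 3, 9, 10, 11],
     [2, 3, 4, 6, 10, 14, 15, 18],
     [1, 2, 3, 4, 5, 6, 7, 12, 14, 18, 20, 21],
     [4, 7, 8, 11, 12, 13, 16, 17, 20, 21],
     [2, 4, 13, 16, 20, 21],
     [1, 2, 3, 5, 7, 16],
     [10, 11, 14, 16, 18],
     [1, 2, 3, 5, 6, 7, 11, 12, 16, 21],
     [1, 2, 3, 4, 5, 6, 13, 16, 21],
     [1, 3, 4, 9, 10, 11, 13, 14, 16, 19, 21],
     [1, 2, 5, 6, 7],
     [4, 6, 8, 10, 11, 13, 14, 16],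
     [2, 6, 11, 21],
     [1, 2, 3, 4, 5, 6, 7, 10, 11, 12, 14, 18, 20],
     [2, 4, 5, 6, 7, 11, 12, 13, 14, 16],
     [1, 5, 6, 7, 11, 12, 16]]"

lemma adjacency_certificate_table_correct:
  "list_all2 (\<lambda>s certs. certified_slices s (zero_exponents s) certs)
     weight_table adjacency_certificate_table"
  by code_simp

lemma nonadjacency_witnesses_correct:
  "list_all2 (\<lambda>s certs. certified_nonslices s (zero_exponents s) certs)
     weight_table nonadjacency_witnesses"
  by code_simp

lemma map_fst_adjacency_certificate_table: "map (map fst) adjacency_certificate_table = neighbor_table"
  by code_simp

lemma map_fst_nonadjacency_witnesses: "map (map fst) nonadjacency_witnesses = nonneighbor_table"
  by code_simp

text \<open>
  Adjacency needs both directions, so the neighbour table has to be symmetric, whereas a single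
  failing direction settles a pair of non-neighbours.
\<close>

lemma neighbor_tables_cover:
  "\<forall>k\<in>set [1..<22]. \<forall>j\<in>set [1..<22]. k = j \<or>
     (if j \<in> set (neighbor_table ! (k - 1)) then k \<in> set (neighbor_table ! (j - 1))
      else j \<in> set (nonneighbor_table ! (k - 1)) \<or> k \<in> set (nonneighbor_table ! (j - 1)))"
  by code_simp

lemma neighbor_table_range:
  "\<forall>k\<in>set [1..<22]. \<forall>j\<in>set (neighbor_table ! (k - 1)). 1 \<le> j \<and> j \<le> 21 \<and> j \<noteq> k"
  by code_simp

lemma nonneighbor_table_range:
  "\<forall>js\<in>set nonneighbor_table. \<forall>j\<in>set js. 1 \<le> j \<and> j \<le> 21"
  by code_simp

lemma length_tables:
  "length adjacency_certificate_table = 21" "length nonadjacency_witnesses = 21"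
  "length neighbor_table = 21"
  by (simp_all add: adjacency_certificate_table_def nonadjacency_witnesses_def neighbor_table_def)

section \<open>The adjacency graph\<close>

lemma leads_to_if_neighbor:
  assumes k: "k \<in> {1..21}" and j: "j \<in> set (neighbor_table ! (k - 1))"
  shows "leads_to k j"
proof -
  let ?s = "weight_table ! (k - 1)" and ?certs = "adjacency_certificate_table ! (k - 1)"
  have "k \<in> set [1..<22]" "k - 1 < 21"
    using k by auto
  then have j': "j \<in> {1..21}"
    using neighbor_table_range j unfolding atLeastAtMost_iff by blast
  have "j \<in> set (map fst ?certs)"
    using j \<open>k - 1 < 21\<close>
    by (simp flip: map_fst_adjacency_certificate_table add: length_tables)
  then obtain \<sigma> rels where "(j, \<sigma>, rels) \<in> set ?certs"
    by auto
  moreover have "certified_slices ?s (zero_exponents ?s) ?certs"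
    using adjacency_certificate_table_correct \<open>k - 1 < 21\<close>
    by (simp add: list_all2_conv_all_nth length_weight_table)
  ultimately have det: "determines (zero_exponents ?s) ?s" and \<sigma>: "\<sigma> = 1 \<or> \<sigma> = -1"
    and cert: "certifies_maximal ?s (zero_exponents ?s) (map ((*) \<sigma>) (weight_table ! (j - 1))) rels"
    unfolding certified_slices_def list_all_iff by blast+
  from \<sigma> show ?thesis
  proof
    assume "\<sigma> = 1"
    then have "map ((*) \<sigma>) (weight_table ! (j - 1)) = entries (wvec j)"
      by (simp add: entries_wvec[OF j'] map_idI)
    then have "exps_ge (wvec j) \<inter> exps_eq (wvec k) \<in> maximal_slices (wvec k)"
      using certifies_maximal_sound[of "wvec k" "wvec j"] det cert wvec_zero_sum[OF j']
      by (simp add: entries_wvec[OF k])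
    then show ?thesis
      unfolding leads_to_def by blast
  next
    assume "\<sigma> = -1"
    then have "map ((*) \<sigma>) (weight_table ! (j - 1)) = entries (- wvec j)"
      by (simp add: entries_minus entries_wvec[OF j'])
    then have "exps_ge (- wvec j) \<inter> exps_eq (wvec k) \<in> maximal_slices (wvec k)"
      using certifies_maximal_sound[of "wvec k" "- wvec j"] det cert wvec_zero_sum[OF j']
      by (simp add: entries_wvec[OF k] zero_sum_weights_minus)
    then show ?thesis
      unfolding leads_to_def by blast
  qed
qed

lemma not_leads_to_if_nonneighbor:
  assumes k: "k \<in> {1..21}" and j: "j \<in> set (nonneighbor_table ! (k - 1))"
  shows "\<not> leads_to k j"
proof -
  let ?s = "weight_table ! (k - 1)" and ?certs = "nonadjacency_witnesses ! (k - 1)"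
  have len: "k - 1 < 21" "length nonneighbor_table = 21"
    using k by (auto simp: nonneighbor_table_def)
  then have "nonneighbor_table ! (k - 1) \<in> set nonneighbor_table"
    by simp
  then have j': "j \<in> {1..21}"
    using nonneighbor_table_range j unfolding atLeastAtMost_iff by blast
  have "j \<in> set (map fst ?certs)"
    using j len(1) by (simp flip: map_fst_nonadjacency_witnesses add: length_tables)
  then obtain w w' where "(j, w, w') \<in> set ?certs"
    by auto
  moreover have "certified_nonslices ?s (zero_exponents ?s) ?certs"
    using nonadjacency_witnesses_correct len(1)
    by (simp add: list_all2_conv_all_nth length_weight_table)
  ultimately have
    "certifies_not_maximal ?s (zero_exponents ?s) (weight_table ! (j - 1)) w"
    "certifies_not_maximal ?s (zero_exponents ?s) (map uminus (weight_table ! (j - 1))) w'"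
    unfolding certified_nonslices_def list_all_iff by blast+
  then have "exps_ge (wvec j) \<inter> exps_eq (wvec k) \<notin> maximal_slices (wvec k)"
    "exps_ge (- wvec j) \<inter> exps_eq (wvec k) \<notin> maximal_slices (wvec k)"
    using certifies_not_maximal_sound[of "wvec k" "wvec j" w]
      certifies_not_maximal_sound[of "wvec k" "- wvec j" w']
    by (simp_all add: entries_wvec[OF k] entries_wvec[OF j'] entries_minus)
  then show ?thesis
    unfolding leads_to_def by blast
qed

lemma adjacent_iff:
  assumes k: "k \<in> {1..21}" and j: "j \<in> {1..21}"
  shows "adjacent k j \<longleftrightarrow> j \<in> set (neighbor_table ! (k - 1))"
proof -
  have mem: "k \<in> set [1..<22]" "j \<in> set [1..<22]"
    using k j by auto
  then have "k = j \<or> (if j \<in> set (neighbor_table ! (k - 1)) then k \<in> set (neighbor_table ! (j - 1))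
      else j \<in> set (nonneighbor_table ! (k - 1)) \<or> k \<in> set (nonneighbor_table ! (j - 1)))"
    by (rule neighbor_tables_cover[rule_format])
  moreover have "k \<notin> set (neighbor_table ! (k - 1))"
    using neighbor_table_range mem(1) by blast
  ultimately show ?thesis
    using leads_to_if_neighbor not_leads_to_if_nonneighbor k j
    unfolding adjacent_def by (metis (full_types))
qed

lemma stratum_eq_iff: "stratum i = stratum j \<longleftrightarrow> i = j"
  by (auto simp: stratum_def)

lemma adjacent_commute: "adjacent i j \<longleftrightarrow> adjacent j i"
  by (auto simp: adjacent_def)

lemma wall_edge_iff:
  assumes "i \<in> {1..21}" "j \<in> {1..21}"
  shows "{stratum i, stratum j} \<in> wall_edges \<longleftrightarrow> adjacent i j"
  using assms adjacent_commute
  by (auto simp: wall_edges_def doubleton_eq_iff stratum_eq_iff)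

lemma neighbors_eq:
  assumes k: "k \<in> {1..21}"
  shows "neighbors k = set (neighbor_table ! (k - 1))"
proof -
  have "k \<in> set [1..<22]"
    using k by auto
  then have "\<forall>j\<in>set (neighbor_table ! (k - 1)). j \<in> {1..21} \<and> j \<noteq> k"
    using neighbor_table_range unfolding atLeastAtMost_iff by blast
  moreover have "neighbors k = {j \<in> {1..21}. j \<noteq> k \<and> j \<in> set (neighbor_table ! (k - 1))}"
    unfolding neighbors_def using wall_edge_iff[OF k] adjacent_iff[OF k] by blast
  ultimately show ?thesis
    by blast
qed

text \<open>
  Each edge appears once, as the pair with its smaller vertex first, so the edges can be counted by
  the length of the list.
\<close>

definition edge_list :: "(nat \<times> nat) list" where
  "edge_list =
     concat (map (\<lambda>i. map (Pair i) (filter (\<lambda>j. i < j) (neighbor_table ! (i - 1)))) [1..<22])"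

lemma card_wall_edges: "card wall_edges = 56"
proof -
  have set_eq: "set edge_list = {(i, j). i \<in> {1..21} \<and> j \<in> {1..21} \<and> i < j \<and> adjacent i j}"
  proof -
    have "(i, j) \<in> set edge_list \<longleftrightarrow> i \<in> {1..21} \<and> i < j \<and> j \<in> set (neighbor_table ! (i - 1))" for i j
      by (auto simp: edge_list_def simp del: upt_rec_numeral)
    moreover have "j \<in> {1..21}" if "i \<in> {1..21}" "j \<in> set (neighbor_table ! (i - 1))" for i j
      using neighbors_eq[OF that(1)] that(2) by (auto simp: neighbors_def)
    ultimately show ?thesis
      using adjacent_iff by blast
  qed
  have edges: "wall_edges = (\<lambda>(i, j). {stratum i, stratum j}) ` set edge_list"
  proof (intro equalityI subsetI)
    fix e assume "e \<in> wall_edges"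
    then obtain i j where ij: "e = {stratum i, stratum j}" "i \<in> {1..21}" "j \<in> {1..21}" "adjacent i j"
      by (auto simp: wall_edges_def)
    then consider "i < j" | "j < i"
      by (metis adjacent_def linorder_neqE_nat)
    then show "e \<in> (\<lambda>(i, j). {stratum i, stratum j}) ` set edge_list"
    proof cases
      case 1
      then have "(i, j) \<in> set edge_list"
        using ij by (simp add: set_eq)
      then show ?thesis
        using ij(1) by force
    next
      case 2
      then have "(j, i) \<in> set edge_list"
        using ij adjacent_commute by (simp add: set_eq)
      then show ?thesis
        using ij(1) by (force simp: insert_commute)
    qed
  qed (use set_eq in \<open>auto simp: wall_edges_def\<close>)
  have inj: "inj_on (\<lambda>(i, j). {stratum i, stratum j}) (set edge_list)"
    unfolding set_eq inj_on_def by (auto simp: doubleton_eq_iff stratum_eq_iff)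
  have "card wall_edges = card (set edge_list)"
    unfolding edges by (rule card_image[OF inj])
  also have "\<dots> = length edge_list"
  proof (rule distinct_card)
    show "distinct edge_list" by code_simp
  qed
  also have "\<dots> = 56" by code_simp
  finally show ?thesis .
qed

theorem theoremE:
  shows "let N = (\<lambda>k::nat.
         [{3, 5, 7, 10},
          {3, 4, 5, 9},
          {1, 2, 4, 5, 9, 10, 12},
          {2, 3, 5, 6, 12, 13, 18},
          {1, 2, 3, 4, 6, 7, 12},
          {4, 5, 12, 15},
          {1, 5, 12, 17},
          {10, 11, 13, 15, 16, 19},
          {2, 3, 10, 14, 18, 19},
          {1, 3, 8, 9, 11, 14, 18},
          {8, 10, 14},
          {3, 4, 5, 6, 7, 15, 17},
          {4, 8, 18, 19},
          {9, 10, 11, 18},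
          {6, 8, 12, 17, 18, 20},
          {8, 18, 19},
          {7, 12, 15, 18, 19, 20, 21},
          {4, 9, 10, 13, 14, 15, 16, 17, 20},
          {8, 9, 13, 16, 17, 21},
          {15, 17, 18, 21},
          {17, 19, 20}] ! (k - 1))
     in card wall_vertices = 21
      \<and> card wall_edges = 56
      \<and> (\<forall>k\<in>{1..21}. neighbors k = N k)
      \<and> (\<forall>i\<in>{1..21}. \<forall>j\<in>{1..21}. i \<noteq> j \<and> j \<notin> N i \<longrightarrow>
            {stratum i, stratum j} \<notin> wall_edges)
      \<and> (\<forall>v\<in>wall_vertices. \<exists>e\<in>wall_edges. v \<in> e)"
proof -
  have table: "[{3, 5, 7, 10},
          {3, 4, 5, 9},
          {1, 2, 4, 5, 9, 10, 12},
          {2, 3, 5, 6, 12, 13, 18},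
          {1, 2, 3, 4, 6, 7, 12},
          {4, 5, 12, 15},
          {1, 5, 12, 17},
          {10, 11, 13, 15, 16, 19},
          {2, 3, 10, 14, 18, 19},
          {1, 3, 8, 9, 11, 14, 18},
          {8, 10, 14},
          {3, 4, 5, 6, 7, 15, 17},
          {4, 8, 18, 19},
          {9, 10, 11, 18},
          {6, 8, 12, 17, 18, 20},
          {8, 18, 19},
          {7, 12, 15, 18, 19, 20, 21},
          {4, 9, 10, 13, 14, 15, 16, 17, 20},
          {8, 9, 13, 16, 17, 21},
          {15, 17, 18, 21},
          {17, 19, 20}] = map set neighbor_table"
    by (simp add: neighbor_table_def)
  have nth: "map set neighbor_table ! (k - 1) = neighbors k" if "k \<in> {1..21}" for k
  proof -
    have "k - 1 < length neighbor_table"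
      using that length_tables(3) by auto
    then show ?thesis
      by (simp only: nth_map neighbors_eq[OF that])
  qed
  have "inj_on stratum {1..21}"
    by (simp add: inj_on_def stratum_eq_iff)
  then have "card wall_vertices = 21"
    by (simp add: wall_vertices_def card_image)
  moreover have "\<forall>i\<in>{1..21}. \<forall>j\<in>{1..21}. i \<noteq> j \<and> j \<notin> map set neighbor_table ! (i - 1) \<longrightarrow>
      {stratum i, stratum j} \<notin> wall_edges"
    using nth unfolding neighbors_def by blast
  moreover have "\<exists>e\<in>wall_edges. v \<in> e" if v: "v \<in> wall_vertices" for v
  proof -
    obtain k where k: "k \<in> {1..21}" "v = stratum k"
      using v unfolding wall_vertices_def by blast
    have "\<forall>js\<in>set neighbor_table. js \<noteq> []"
      by (simp add: neighbor_table_def)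
    moreover have "neighbor_table ! (k - 1) \<in> set neighbor_table"
      using k(1) length_tables(3) by (intro nth_mem) auto
    ultimately have "neighbors k \<noteq> {}"
      using neighbors_eq[OF k(1)] by auto
    then obtain j where "{stratum k, stratum j} \<in> wall_edges"
      by (auto simp: neighbors_def)
    then show ?thesis
      using k(2) by blast
  qed
  ultimately show ?thesis
    unfolding table Let_def using card_wall_edges nth by blast
qed

end
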